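(* Let $a_1,\dots,a_6$ be non-negative integers, not all zero, such that $a_1+a_6\ge\max\{a_2+a_5,\ a_3+a_4\}$, and let $I\subset R=K[x_1,x_2,x_3,x_4]$ be the defining ideal of the tetrahedral curve $C(a_1,\dots,a_6)$. Then $$H^1_{\mathfrak m}(R/I)\cong K[S]$$ as graded modules over $R$.
   Context: $K$ is a field, $R=K[x_1,x_2,x_3,x_4]$, $\mathfrak m=(x_1,x_2,x_3,x_4)$, and the defining ideal of the tetrahedral curve $C(a_1,\dots,a_6)$ is $$I=(x_1,x_2)^{a_1}\cap(x_1,x_3)^{a_2}\cap(x_1,x_4)^{a_3}\cap(x_2,x_3)^{a_4}\cap(x_2,x_4)^{a_5}\cap(x_3,x_4)^{a_6},$$ where $\mathfrak p^0=R$. With $\mathbb N=\{0,1,2,\dots\}$ put $$T_1=\{\underline y\in\mathbb N^4\mid y_1+y_3\ge a_2,\ y_1+y_4\ge a_3,\ y_2+y_3\ge a_4,\ y_2+y_4\ge a_5\},$$ $$T_2=\{\underline y\in T_1\mid y_1+y_2\ge a_1\},\qquad T_3=\{\underline y\in T_1\mid y_3+y_4\ge a_6\},\qquad S=T_1\setminus(T_2\cup T_3).$$ For a subset $T\subseteq\mathbb N^4$, $K[T]$ denotes the $K$-vector subspace of $R$ spanned by the monomials $\underline x^{\underline\alpha}=x_1^{\alpha_1}\cdots x_4^{\alpha_4}$ with $\underline\alpha\in T$. $K[T_1],K[T_2],K[T_3]$ are ideals of $R$, and $K[S]$ is regarded as the graded $R$-module $K[T_1]/(K[T_2]+K[T_3])$;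 that is, for $\underline\alpha\in S$ and $\underline\beta\in\mathbb N^4$, $\underline x^{\underline\beta}\cdot\underline x^{\underline\alpha}=\underline x^{\underline\beta+\underline\alpha}$ if $\underline\beta+\underline\alpha\in S$, and $=0$ otherwise. *)

theory Defs
  imports
    "HOL-Algebra.Algebra"
    "HOL-Algebra.Algebraic_Closure_Type"
    "HOL-Library.Poly_Mapping"
begin

section \<open>The polynomial ring in four variables\<close>

datatype var = X1 | X2 | X3 | X4

text \<open>An exponent vector \<open>y \<in> \<nat>\<^sup>4\<close> is a map \<open>var \<Rightarrow>\<^sub>0 nat\<close>; a polynomial maps
  exponent vectors to coefficients, and the product on this type is the convolution product.\<close>

type_synonym expo = "var \<Rightarrow>\<^sub>0 nat"
type_synonym 'k mpoly4 = "expo \<Rightarrow>\<^sub>0 'k"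

abbreviation coord :: "expo \<Rightarrow> var \<Rightarrow> nat" where
  "coord y v \<equiv> Poly_Mapping.lookup y v"

definition total_degree :: "expo \<Rightarrow> nat" where
  "total_degree y = coord y X1 + coord y X2 + coord y X3 + coord y X4"

abbreviation polyring :: "'k::field mpoly4 ring" where
  "polyring \<equiv> ring_of_type_algebra"

definition indet :: "var \<Rightarrow> 'k::field mpoly4" where
  "indet v = Poly_Mapping.single (Poly_Mapping.single v 1) 1"

definition homogeneous :: "int \<Rightarrow> 'k::field mpoly4 set" where
  "homogeneous d = {p. \<forall>y\<in>Poly_Mapping.keys p. int (total_degree y) = d}"

definition ideal_power :: "'k::field mpoly4 set \<Rightarrow> nat \<Rightarrow> 'k mpoly4 set" where
  "ideal_power I n = I [^]\<^bsub>ideals_set polyring\<^esub> n"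

definition max_ideal :: "'k::field mpoly4 set" where
  "max_ideal = genideal polyring {indet X1, indet X2, indet X3, indet X4}"


section \<open>Graded modules\<close>

text \<open>The fields \<^const>\<open>monoid.mult\<close> and \<^const>\<open>monoid.one\<close>, which the record of modules inherits from rings, carry no
  meaning for a module.\<close>

record ('r, 'm) grmod = "('r, 'm) module" +
  component :: "int \<Rightarrow> 'm set"

locale graded_module = module "polyring :: 'k::field mpoly4 ring" M
  for M :: "('k::field mpoly4, 'm) grmod" (structure) +
  assumes component_subgroup: "\<And>d. subgroup (component M d) (add_monoid M)"
    and decomposition: "\<And>x. x \<in> carrier M \<Longrightarrow>
      \<exists>!c. (\<forall>d. c d \<in> component M d) \<and> finite {d. c d \<noteq> \<zero>\<^bsub>M\<^esub>} \<and>
           x = (\<Oplus>\<^bsub>M\<^esub>d\<in>{d. c d \<noteq> \<zero>\<^bsub>M\<^esub>}. c d)"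
    and component_smult: "\<And>i j r x. r \<in> homogeneous i \<Longrightarrow> x \<in> component M j \<Longrightarrow>
      r \<odot>\<^bsub>M\<^esub> x \<in> component M (i + j)"

definition graded_hom ::
    "('k::field mpoly4, 'm) grmod \<Rightarrow> ('k mpoly4, 'n) grmod \<Rightarrow> ('m \<Rightarrow> 'n) set" where
  "graded_hom M N = {f \<in> hom (add_monoid M) (add_monoid N).
     (\<forall>r. \<forall>x\<in>carrier M. f (r \<odot>\<^bsub>M\<^esub> x) = r \<odot>\<^bsub>N\<^esub> f x) \<and>
     (\<forall>d. f ` component M d \<subseteq> component N d)}"

definition graded_isomorphic ::
    "('k::field mpoly4, 'm) grmod \<Rightarrow> ('k mpoly4, 'n) grmod \<Rightarrow> bool" where
  "graded_isomorphic M N \<longleftrightarrow> (\<exists>f\<in>graded_hom M N.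
     bij_betw f (carrier M) (carrier N) \<and> (\<forall>d. f ` component M d = component N d))"

definition regular_module :: "('k::field mpoly4, 'k mpoly4) grmod" where
  "regular_module = \<lparr>carrier = UNIV, monoid.mult = (*), one = 1, ring.zero = 0, add = (+), module.smult = (*),
     component = homogeneous\<rparr>"

definition sub_grmod :: "('k::field mpoly4, 'm) grmod \<Rightarrow> 'm set \<Rightarrow> ('k mpoly4, 'm) grmod" where
  "sub_grmod M A = M\<lparr>carrier := A, component := (\<lambda>d. component M d \<inter> A)\<rparr>"

definition graded_submodule :: "'m set \<Rightarrow> ('k::field mpoly4, 'm) grmod \<Rightarrow> bool" where
  "graded_submodule A M \<longleftrightarrow> submodule A polyring M \<and> graded_module (sub_grmod M A)"

text \<open>\<open>M/A\<close>, with additive cosets as elements and the images of the components of \<open>M\<close> as components.\<close>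

definition quotient_grmod ::
    "('k::field mpoly4, 'm) grmod \<Rightarrow> 'm set \<Rightarrow> ('k mpoly4, 'm set) grmod" where
  "quotient_grmod M A = \<lparr>carrier = a_rcosets\<^bsub>M\<^esub> A, monoid.mult = undefined, one = undefined,
     ring.zero = A, add = set_add M, module.smult = (\<lambda>r C. \<Union>x\<in>C. A +>\<^bsub>M\<^esub> (r \<odot>\<^bsub>M\<^esub> x)),
     component = (\<lambda>d. (\<lambda>x. A +>\<^bsub>M\<^esub> x) ` component M d)\<rparr>"


section \<open>Local cohomology\<close>

text \<open>Local cohomology is the right derived functor of \<open>\<Gamma>\<^sub>\<mm>\<close> on the category of graded \<open>R\<close>-modules with
  homomorphisms of degree 0, which is what gives \<open>H\<^sup>i\<^sub>\<mm>(M)\<close> its grading.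

  In the definition of injectivity the extension property cannot be quantified over modules \<open>B\<close> on
  all types. Here \<open>B\<close> ranges over the graded modules whose elements have the type of the cosets in
  \<open>R\<^bsup>(\<nat>)\<^esup>\<close>, so up to isomorphism over all countably generated ones. This is no restriction: by the
  graded form of Baer's criterion the twists \<open>B = R(j)\<close> alone are enough.\<close>

definition graded_injective :: "('k::field mpoly4, 'e) grmod \<Rightarrow> bool" where
  "graded_injective E \<longleftrightarrow> graded_module E \<and>
     (\<forall>(B :: ('k mpoly4, (nat \<Rightarrow>\<^sub>0 'k mpoly4) set) grmod) A f.
        graded_module B \<and> graded_submodule A B \<and> f \<in> graded_hom (sub_grmod B A) E \<longrightarrow>
        (\<exists>g\<in>graded_hom B E. \<forall>x\<in>A. g x = f x))"

text \<open>\<open>0 \<rightarrow> M \<rightarrow> E\<^sup>0 \<rightarrow> E\<^sup>1 \<rightarrow> \<dots>\<close>, with augmentation \<open>\<epsilon>\<close> and differentials \<open>\<delta> i : E\<^sup>i \<rightarrow> E\<^bsup>i+1\<^esup>\<close>. That all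
  \<open>E\<^sup>i\<close> live on one type is no restriction, since that type is arbitrary.\<close>

definition graded_injective_resolution ::
    "('k::field mpoly4, 'm) grmod \<Rightarrow> ('m \<Rightarrow> 'e) \<Rightarrow> (nat \<Rightarrow> ('k mpoly4, 'e) grmod) \<Rightarrow>
     (nat \<Rightarrow> 'e \<Rightarrow> 'e) \<Rightarrow> bool" where
  "graded_injective_resolution M \<epsilon> E \<delta> \<longleftrightarrow>
     graded_module M \<and> (\<forall>i. graded_injective (E i)) \<and>
     \<epsilon> \<in> graded_hom M (E 0) \<and> (\<forall>i. \<delta> i \<in> graded_hom (E i) (E (Suc i))) \<and>
     inj_on \<epsilon> (carrier M) \<and>
     \<epsilon> ` carrier M = a_kernel (E 0) (E 1) (\<delta> 0) \<and>
     (\<forall>i. \<delta> i ` carrier (E i) = a_kernel (E (Suc i)) (E (Suc (Suc i))) (\<delta> (Suc i)))"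

definition torsion :: "('k::field mpoly4, 'm) grmod \<Rightarrow> 'm set" (\<open>\<Gamma>\<^sub>\<mm>\<close>) where
  "\<Gamma>\<^sub>\<mm> M = {x \<in> carrier M. \<exists>n. \<forall>r\<in>ideal_power max_ideal n. r \<odot>\<^bsub>M\<^esub> x = \<zero>\<^bsub>M\<^esub>}"

text \<open>\<open>H\<^sup>i(\<Gamma>\<^sub>\<mm>(E\<^sup>\<bullet>))\<close>, which is \<open>H\<^sup>i\<^sub>\<mm>(M)\<close> when \<open>E\<^sup>\<bullet>\<close> is a graded injective resolution of \<open>M\<close>.\<close>

definition local_cohomology ::
    "(nat \<Rightarrow> ('k::field mpoly4, 'e) grmod) \<Rightarrow> (nat \<Rightarrow> 'e \<Rightarrow> 'e) \<Rightarrow> nat \<Rightarrow> ('k mpoly4, 'e set) grmod"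
  where
  "local_cohomology E \<delta> i = quotient_grmod
     (sub_grmod (E i) (\<Gamma>\<^sub>\<mm> (E i) \<inter> a_kernel (E i) (E (Suc i)) (\<delta> i)))
     (case i of 0 \<Rightarrow> {\<zero>\<^bsub>E 0\<^esub>} | Suc j \<Rightarrow> \<delta> j ` \<Gamma>\<^sub>\<mm> (E j))"


section \<open>Tetrahedral curves\<close>

definition pair_ideal :: "var \<Rightarrow> var \<Rightarrow> 'k::field mpoly4 set" where
  "pair_ideal u v = genideal polyring {indet u, indet v}"

definition tetrahedral_ideal ::
    "nat \<Rightarrow> nat \<Rightarrow> nat \<Rightarrow> nat \<Rightarrow> nat \<Rightarrow> nat \<Rightarrow> 'k::field mpoly4 set" where
  "tetrahedral_ideal a1 a2 a3 a4 a5 a6 =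
     ideal_power (pair_ideal X1 X2) a1 \<inter> ideal_power (pair_ideal X1 X3) a2 \<inter>
     ideal_power (pair_ideal X1 X4) a3 \<inter> ideal_power (pair_ideal X2 X3) a4 \<inter>
     ideal_power (pair_ideal X2 X4) a5 \<inter> ideal_power (pair_ideal X3 X4) a6"

definition T1 :: "nat \<Rightarrow> nat \<Rightarrow> nat \<Rightarrow> nat \<Rightarrow> expo set" where
  "T1 a2 a3 a4 a5 = {y. coord y X1 + coord y X3 \<ge> a2 \<and> coord y X1 + coord y X4 \<ge> a3 \<and>
     coord y X2 + coord y X3 \<ge> a4 \<and> coord y X2 + coord y X4 \<ge> a5}"

definition T2 :: "nat \<Rightarrow> nat \<Rightarrow> nat \<Rightarrow> nat \<Rightarrow> nat \<Rightarrow> expo set" where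
  "T2 a1 a2 a3 a4 a5 = {y \<in> T1 a2 a3 a4 a5. coord y X1 + coord y X2 \<ge> a1}"

definition T3 :: "nat \<Rightarrow> nat \<Rightarrow> nat \<Rightarrow> nat \<Rightarrow> nat \<Rightarrow> expo set" where
  "T3 a2 a3 a4 a5 a6 = {y \<in> T1 a2 a3 a4 a5. coord y X3 + coord y X4 \<ge> a6}"

text \<open>The \<open>K\<close>-span of the monomials with exponent in \<open>T\<close>.\<close>

definition monomial_span :: "expo set \<Rightarrow> 'k::field mpoly4 set" where
  "monomial_span T = {p. Poly_Mapping.keys p \<subseteq> T}"

text \<open>\<open>K[S]\<close> as the graded module \<open>K[T\<^sub>1]/(K[T\<^sub>2] + K[T\<^sub>3])\<close>, where \<open>S = T\<^sub>1 - (T\<^sub>2 \<union> T\<^sub>3)\<close>; the monomials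
  with exponent in \<open>S\<close> represent a \<open>K\<close>-basis of it.\<close>

definition KS_module ::
    "nat \<Rightarrow> nat \<Rightarrow> nat \<Rightarrow> nat \<Rightarrow> nat \<Rightarrow> nat \<Rightarrow> ('k::field mpoly4, 'k mpoly4 set) grmod" where
  "KS_module a1 a2 a3 a4 a5 a6 = quotient_grmod
     (sub_grmod regular_module (monomial_span (T1 a2 a3 a4 a5)))
     (monomial_span (T2 a1 a2 a3 a4 a5) <+>\<^bsub>regular_module\<^esub> monomial_span (T3 a2 a3 a4 a5 a6))"

end

theory Submission
  imports Defs
begin

text \<open>Write \<open>\<Gamma>\<close> for the functor of \<open>\<mm>\<close>-torsion elements and \<open>\<eta> : R \<rightarrow> R/I \<rightarrow> E\<^sup>0\<close> for the augmentation.
  By exactness a class in \<open>H\<^sup>1(\<Gamma>(E\<^sup>\<bullet>))\<close> is represented by \<open>\<delta>\<^sup>0 e\<close> with \<open>\<mm>\<^sup>n e \<subseteq> \<eta>(R)\<close> for some \<open>n\<close>, and it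
  vanishes exactly if \<open>e \<in> \<eta>(R) + \<Gamma>(E\<^sup>0)\<close>. So \<open>H\<^sup>1\<^sub>\<mm>(R/I)\<close> consists of the elements that multiply into
  \<open>R/I\<close> under a power of \<open>\<mm>\<close>, modulo those of \<open>R/I\<close> itself and up to torsion.

  Such elements come from \<open>K[T\<^sub>1]\<close>. The ideal \<open>I\<close> is \<open>K[T\<^sub>2] \<inter> K[T\<^sub>3]\<close>, so \<open>R/I\<close> sits diagonally in
  \<open>R/K[T\<^sub>2] \<oplus> R/K[T\<^sub>3]\<close>. A high power of a variable moves any \<open>f \<in> K[T\<^sub>1]\<close> into \<open>K[T\<^sub>2]\<close> or \<open>K[T\<^sub>3]\<close>, hence
  moves \<open>(f, 0)\<close> into the diagonal. To have this element inside \<open>E\<^sup>0\<close>, the homomorphism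
  \<open>K[T\<^sub>2] + K[T\<^sub>3] \<rightarrow> E\<^sup>0\<close> that vanishes on \<open>K[T\<^sub>2]\<close> and equals \<open>\<eta>\<close> on \<open>K[T\<^sub>3]\<close> is extended to \<open>\<phi> : R \<rightarrow> E\<^sup>0\<close> by
  graded injectivity (\<open>graded_injective_extend\<close>). The isomorphism is induced by
  \<open>f \<mapsto> \<delta>\<^sup>0 (\<phi> f)\<close> on \<open>K[T\<^sub>1]\<close>.

  Its kernel is \<open>K[T\<^sub>2] + K[T\<^sub>3]\<close> because \<open>R/K[T\<^sub>2]\<close> and \<open>R/K[T\<^sub>3]\<close> have no torsion
  (\<open>u_coboundary_iff\<close>). Surjectivity says that every \<open>e\<close> as above is represented by a pair \<open>(p, r)\<close> with
  \<open>p - r \<in> K[T\<^sub>1]\<close> (\<open>cocycle_decomposition\<close>). This is where the inequality on \<open>a\<close> enters: coefficient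
  by coefficient, representatives of the products \<open>x\<^sub>v\<^sup>N e\<close> agree along the edges of a graph on the four
  variables, and the inequality makes this graph connected except at the exponents in \<open>S\<close>
  (\<open>glue_along_edges\<close>).\<close>



section \<open>Monomial ideals of the polynomial ring\<close>

abbreviation coef :: "'k::field mpoly4 \<Rightarrow> expo \<Rightarrow> 'k" where
  "coef \<equiv> Poly_Mapping.lookup"

lemma polyring_simps [simp]:
  "carrier (polyring :: 'k::field mpoly4 ring) = UNIV"
  "(x \<otimes>\<^bsub>polyring\<^esub> y :: 'k mpoly4) = x * y"
  "(x \<oplus>\<^bsub>polyring\<^esub> y :: 'k mpoly4) = x + y"
  "\<one>\<^bsub>polyring\<^esub> = (1 :: 'k mpoly4)"
  "\<zero>\<^bsub>polyring\<^esub> = (0 :: 'k mpoly4)"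
  by (simp_all add: ring_of_type_algebra_def)

lemma cring_polyring: "cring (polyring :: 'k::field mpoly4 ring)"
  by (rule cring_from_type_algebra)

text \<open>These are the sets \<open>T\<close> for which \<open>K[T]\<close> is an ideal.\<close>

definition upset :: "expo set \<Rightarrow> bool" where
  "upset T \<longleftrightarrow> (\<forall>y\<in>T. \<forall>z. y + z \<in> T)"

lemma upset_Int: "upset S \<Longrightarrow> upset T \<Longrightarrow> upset (S \<inter> T)"
  and upset_Un: "upset S \<Longrightarrow> upset T \<Longrightarrow> upset (S \<union> T)"
  and upset_UNIV: "upset UNIV"
  by (auto simp: upset_def)

lemma monomial_span_iff: "p \<in> monomial_span T \<longleftrightarrow> (\<forall>y. y \<notin> T \<longrightarrow> coef p y = 0)"
  by (auto simp: monomial_span_def in_keys_iff)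

lemma monomial_span_UNIV [simp]: "monomial_span UNIV = UNIV"
  by (auto simp: monomial_span_iff)

lemma monomial_span_mono: "S \<subseteq> T \<Longrightarrow> monomial_span S \<subseteq> monomial_span T"
  by (auto simp: monomial_span_def)

lemma monomial_span_zero [simp]: "0 \<in> monomial_span T"
  and monomial_span_add: "p \<in> monomial_span T \<Longrightarrow> q \<in> monomial_span T \<Longrightarrow> p + q \<in> monomial_span T"
  and monomial_span_uminus: "p \<in> monomial_span T \<Longrightarrow> - p \<in> monomial_span T"
  and monomial_span_Int: "monomial_span S \<inter> monomial_span T = monomial_span (S \<inter> T)"
  by (auto simp: monomial_span_iff lookup_add lookup_minus)

lemma keys_mult_subset:
  fixes p q :: "'k::field mpoly4"
  assumes "y \<in> Poly_Mapping.keys (p * q)"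
  obtains a b where "a \<in> Poly_Mapping.keys p" "b \<in> Poly_Mapping.keys q" "y = a + b"
  using keys_mult[of p q] assms by auto

lemma monomial_span_mult:
  fixes p q :: "'k::field mpoly4"
  assumes "upset T" "q \<in> monomial_span T"
  shows "p * q \<in> monomial_span T"
  using assms unfolding monomial_span_def upset_def
  by (auto elim!: keys_mult_subset simp: add.commute) (metis add.commute subsetD)

text \<open>A polynomial is the sum of its terms, so an additively closed property has to be checked on
  terms only.\<close>

lemma monomial_span_induct [consumes 1, case_names zero add single]:
  fixes p :: "'k::field mpoly4"
  assumes p: "p \<in> monomial_span T"
    and zero: "P 0"
    and add: "\<And>p q. P p \<Longrightarrow> P q \<Longrightarrow> P (p + q)"
    and single: "\<And>y c. y \<in> T \<Longrightarrow> P (Poly_Mapping.single y c)"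
  shows "P p"
proof -
  have *: "finite A \<Longrightarrow> A \<subseteq> T \<Longrightarrow> P (\<Sum>y\<in>A. Poly_Mapping.single y (coef p y))" for A
    by (induction A rule: finite_induct) (auto intro: zero add single)
  have "p = (\<Sum>y\<in>Poly_Mapping.keys p. Poly_Mapping.single y (coef p y))"
    by (rule poly_mapping_eqI) (simp add: lookup_sum lookup_single when_def in_keys_iff)
  with *[of "Poly_Mapping.keys p"] p show ?thesis
    by (simp add: monomial_span_def)
qed

definition restrict_to :: "expo set \<Rightarrow> 'k::field mpoly4 \<Rightarrow> 'k mpoly4" where
  "restrict_to T p = Abs_poly_mapping (\<lambda>y. coef p y when y \<in> T)"

lemma lookup_restrict_to: "coef (restrict_to T p) y = (coef p y when y \<in> T)"
proof -
  have "finite {y. (coef p y when y \<in> T) \<noteq> 0}"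
    by (rule finite_subset[OF _ finite_keys[of p]]) (auto simp: in_keys_iff when_def)
  then show ?thesis
    by (simp add: restrict_to_def)
qed

lemma restrict_to_add: "restrict_to T (p + q) = restrict_to T p + restrict_to T q"
  by (rule poly_mapping_eqI) (simp add: lookup_restrict_to lookup_add when_def)

lemma restrict_to_in_span: "p \<in> monomial_span (S \<union> T) \<Longrightarrow> restrict_to T p \<in> monomial_span T"
  by (auto simp: monomial_span_iff lookup_restrict_to)

lemma restrict_to_span_eq: "p \<in> monomial_span T \<Longrightarrow> restrict_to T p = p"
  by (rule poly_mapping_eqI) (auto simp: monomial_span_iff lookup_restrict_to when_def)

lemma restrict_to_span_Int: "p \<in> monomial_span S \<Longrightarrow> restrict_to T p \<in> monomial_span (S \<inter> T)"
  by (auto simp: monomial_span_iff lookup_restrict_to when_def)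

lemma restrict_to_complement: "p \<in> monomial_span (S \<union> T) \<Longrightarrow> p - restrict_to T p \<in> monomial_span S"
  by (auto simp: monomial_span_iff lookup_restrict_to lookup_minus when_def)


subsection \<open>Powers of the variables\<close>

definition var_power :: "var \<Rightarrow> nat \<Rightarrow> 'k::field mpoly4" where
  "var_power v n = Poly_Mapping.single (Poly_Mapping.single v n) 1"

lemma lookup_single_mult_add:
  fixes p :: "'k::field mpoly4"
  shows "coef (Poly_Mapping.single y 1 * p) (y + z) = coef p z"
proof -
  have *: "coef (Poly_Mapping.single y (1::'k)) l * (\<Sum>q. coef p q when y + z = l + q)
     = (coef p z when l = y)" for l
    by (auto simp: lookup_single when_def)
  show ?thesis
    by (simp add: lookup_mult *)
qed

lemma coord_add [simp]: "coord (y + z) v = coord y v + coord z v"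
  by (rule lookup_add)

lemma coord_single: "coord (Poly_Mapping.single v n) w = (if v = w then n else 0)"
  by (simp add: lookup_single when_def)

lemma add_diff_single: "n \<le> coord y v \<Longrightarrow> Poly_Mapping.single v n + (y - Poly_Mapping.single v n) = y"
  by (rule poly_mapping_eqI) (auto simp: lookup_minus coord_single)

lemma diff_add_single [simp]: "y + Poly_Mapping.single v n - Poly_Mapping.single v n = (y :: expo)"
  by (rule poly_mapping_eqI) (auto simp: lookup_minus)

lemma lookup_var_power_mult:
  fixes p :: "'k::field mpoly4"
  shows "coef (var_power v n * p) y = (if n \<le> coord y v then coef p (y - Poly_Mapping.single v n) else 0)"
proof (cases "n \<le> coord y v")
  case True
  then show ?thesis
    using lookup_single_mult_add[of "Poly_Mapping.single v n" p "y - Poly_Mapping.single v n"]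
    by (simp add: var_power_def add_diff_single)
next
  case False
  have "y \<notin> Poly_Mapping.keys (var_power v n * p)"
    using False by (auto elim!: keys_mult_subset simp: var_power_def coord_single)
  with False show ?thesis
    by (simp add: in_keys_iff)
qed

lemma lookup_var_power_mult_add:
  fixes p :: "'k::field mpoly4"
  shows "coef (var_power v n * p) (y + Poly_Mapping.single v n) = coef p y"
  by (simp add: lookup_var_power_mult coord_single)

lemma var_power_mult: "var_power v m * var_power v n = var_power v (m + n)"
  by (simp add: var_power_def mult_single single_add)

lemma single_split:
  "n \<le> coord y v \<Longrightarrow> Poly_Mapping.single y c = Poly_Mapping.single (y - Poly_Mapping.single v n) c * var_power v n"
  by (simp add: var_power_def mult_single add_diff_single add.commute)

lemma var_power_homogeneous: "var_power v n \<in> homogeneous (int n)"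
  by (cases v) (auto simp: homogeneous_def var_power_def total_degree_def coord_single)


subsection \<open>Powers of ideals generated by variables\<close>

lemma ideal_monomial_span:
  assumes "upset T"
  shows "ideal (monomial_span T :: 'k::field mpoly4 set) polyring"
proof (rule idealI)
  show "ring (polyring :: 'k mpoly4 ring)"
    by (rule ring_from_type_algebra)
  then interpret ring "polyring :: 'k mpoly4 ring" .
  show "subgroup (monomial_span T) (add_monoid (polyring :: 'k mpoly4 ring))"
  proof (rule add.subgroupI, goal_cases)
    case (3 a)
    have "\<ominus>\<^bsub>polyring\<^esub> a = - a"
      by (rule minus_equality) auto
    with 3 show ?case by (simp add: monomial_span_uminus)
  qed (auto intro: monomial_span_add monomial_span_zero)
qed (use assms monomial_span_mult in \<open>auto simp: mult.commute\<close>)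

text \<open>\<open>(x\<^sub>v | v \<in> V)\<^sup>n\<close> is spanned by the monomials whose degree in the variables of \<open>V\<close> is at least
  \<open>n\<close>: such a monomial is divisible by some \<open>x\<^sub>v\<close>, and dividing by it lowers that degree by one. This
  describes the prime powers that define the curve as well as the powers of \<open>\<mm>\<close>.\<close>

lemma ideal_power_genideal_indets:
  fixes V :: "var set"
  assumes "finite V"
  shows "ideal_power (genideal polyring (indet ` V) :: 'k::field mpoly4 set) n =
    monomial_span {y. n \<le> (\<Sum>v\<in>V. coord y v)}"
proof -
  interpret cring "polyring :: 'k mpoly4 ring" by (rule cring_polyring)
  let ?T = "\<lambda>n. {y. n \<le> (\<Sum>v\<in>V. coord y v)}"
  have up: "upset (?T n)" for n
    by (auto simp: upset_def sum.distrib)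
  have div: "\<exists>v\<in>V. 1 \<le> coord y v" if "y \<in> ?T (Suc n)" for y n
    using that by (metis (mono_tags, lifting) One_nat_def less_eq_Suc_le mem_Collect_eq not_less_zero sum.not_neutral_contains_not_neutral gr0I)
  have dec: "y - Poly_Mapping.single v 1 \<in> ?T n" if "y \<in> ?T (Suc n)" "v \<in> V" "1 \<le> coord y v" for y n v
  proof -
    have "y = Poly_Mapping.single v 1 + (y - Poly_Mapping.single v 1)"
      using that by (simp add: add_diff_single)
    then have "(\<Sum>w\<in>V. coord y w) = (\<Sum>w\<in>V. coord (Poly_Mapping.single v 1) w) + (\<Sum>w\<in>V. coord (y - Poly_Mapping.single v 1) w)"
      by (metis (no_types, lifting) coord_add sum.cong sum.distrib)
    also have "(\<Sum>w\<in>V. coord (Poly_Mapping.single v 1) w) = 1"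
      using assms that by (simp add: coord_single)
    finally show ?thesis using that by simp
  qed
  have indet: "(indet v :: 'k mpoly4) = var_power v 1" for v
    by (simp add: indet_def var_power_def)
  have base: "genideal polyring (indet ` V) = (monomial_span (?T 1) :: 'k mpoly4 set)"
  proof (rule antisym)
    show "genideal polyring (indet ` V) \<subseteq> (monomial_span (?T 1) :: 'k mpoly4 set)"
    proof (rule genideal_minimal)
      show "indet ` V \<subseteq> (monomial_span (?T 1) :: 'k mpoly4 set)"
        using assms by (auto simp: indet var_power_def monomial_span_def coord_single)
    qed (rule ideal_monomial_span[OF up])
  next
    have I: "ideal (genideal polyring (indet ` V)) (polyring :: 'k mpoly4 ring)"
      by (rule genideal_ideal) simp
    show "(monomial_span (?T 1) :: 'k mpoly4 set) \<subseteq> genideal polyring (indet ` V)"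
    proof
      fix p :: "'k mpoly4" assume "p \<in> monomial_span (?T 1)"
      then show "p \<in> genideal polyring (indet ` V)"
      proof (induction p rule: monomial_span_induct)
        case zero
        show ?case using additive_subgroup.zero_closed[OF ideal.axioms(1)[OF I]] by simp
      next
        case (add p q)
        then show ?case using additive_subgroup.a_closed[OF ideal.axioms(1)[OF I]] by fastforce
      next
        case (single y c)
        then obtain v where v: "v \<in> V" "1 \<le> coord y v" using div[of y 0] by auto
        have "indet v \<in> genideal polyring (indet ` V :: 'k mpoly4 set)"
          using genideal_self[of "indet ` V"] v by auto
        from ideal.I_l_closed[OF I this, of "Poly_Mapping.single (y - Poly_Mapping.single v 1) c"]
        show ?case
          using v by (simp add: single_split[OF v(2)] indet)
      qed
    qed
  qed
  show ?thesis
  proof (induction n)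
    case 0
    show ?case by (simp add: ideal_power_def nat_pow_def ideals_set_def)
  next
    case (Suc n)
    let ?P = "monomial_span (?T n) :: 'k mpoly4 set" and ?Q = "monomial_span (?T 1) :: 'k mpoly4 set"
    have "ideal_power (genideal polyring (indet ` V)) (Suc n) = ideal_prod polyring ?P ?Q"
      using Suc unfolding ideal_power_def by (simp add: nat_pow_def base) (simp add: ideals_set_def)
    also have "\<dots> = monomial_span (?T (Suc n))"
    proof (intro antisym subsetI)
      fix p assume "p \<in> ideal_prod polyring ?P ?Q"
      then show "p \<in> monomial_span (?T (Suc n))"
      proof (induction rule: ideal_prod.induct)
        case (prod i j)
        then show ?case
          by (force simp: monomial_span_def sum.distrib elim!: keys_mult_subset)
      qed (simp add: monomial_span_add)
    next
      fix p :: "'k mpoly4" assume "p \<in> monomial_span (?T (Suc n))"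
      then show "p \<in> ideal_prod polyring ?P ?Q"
      proof (induction p rule: monomial_span_induct)
        case zero
        show ?case using ideal_prod.prod[of 0 ?P 0 ?Q polyring] by simp
      next
        case (add p q)
        then show ?case using ideal_prod.sum[of p polyring ?P ?Q q] by simp
      next
        case (single y c)
        then obtain v where v: "v \<in> V" "1 \<le> coord y v" using div[of y n] by auto
        have "Poly_Mapping.single (y - Poly_Mapping.single v 1) c \<in> ?P"
          using dec[OF single v] by (auto simp: monomial_span_def)
        moreover have "var_power v 1 \<in> ?Q"
          using v assms by (auto simp: var_power_def monomial_span_def coord_single)
        ultimately show ?case
          using ideal_prod.prod[of _ ?P _ ?Q polyring] by (simp add: single_split[OF v(2)])
      qed
    qed
    finally show ?case .
  qed
qed

lemma ideal_power_pair_ideal: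
  assumes "u \<noteq> v"
  shows "ideal_power (pair_ideal u v :: 'k::field mpoly4 set) n = monomial_span {y. n \<le> coord y u + coord y v}"
  using ideal_power_genideal_indets[of "{u, v}" n] assms by (simp add: pair_ideal_def)

lemma ideal_power_max_ideal:
  "ideal_power (max_ideal :: 'k::field mpoly4 set) n = monomial_span {y. n \<le> total_degree y}"
  using ideal_power_genideal_indets[of "{X1, X2, X3, X4}" n]
  by (simp add: max_ideal_def total_degree_def add.assoc)

lemma upset_T: "upset (T1 a2 a3 a4 a5)" "upset (T2 a1 a2 a3 a4 a5)" "upset (T3 a2 a3 a4 a5 a6)"
  by (auto simp: upset_def T1_def T2_def T3_def)

lemma tetrahedral_ideal_eq:
  "tetrahedral_ideal a1 a2 a3 a4 a5 a6 = monomial_span (T2 a1 a2 a3 a4 a5 \<inter> T3 a2 a3 a4 a5 a6)"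
  unfolding tetrahedral_ideal_def
  by (simp add: ideal_power_pair_ideal monomial_span_Int)
     (rule arg_cong[where f = monomial_span], auto simp: T1_def T2_def T3_def)


section \<open>Homomorphisms and quotients of modules\<close>

lemma module_sub_grmod:
  fixes M :: "('k::field mpoly4, 'm) grmod"
  assumes "module polyring M" "submodule A polyring M"
  shows "module polyring (sub_grmod M A)"
proof -
  interpret N: module "polyring :: 'k mpoly4 ring" "M\<lparr>carrier := A\<rparr>"
    by (rule submodule.submodule_is_module[OF assms(2,1)])
  have "abelian_group (sub_grmod M A)"
    using N.abelian_group_axioms
    by (simp add: abelian_group_def abelian_monoid_def abelian_group_axioms_def sub_grmod_def)
  then show ?thesis
    by (intro moduleI cring_polyring)
       (use N.smult_closed N.smult_l_distr N.smult_r_distr N.smult_assoc1 N.smult_one in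
         \<open>simp_all add: sub_grmod_def\<close>)
qed

lemma (in abelian_group) minus_eq_zero_iff:
  assumes "x \<in> carrier G" "y \<in> carrier G"
  shows "x \<ominus> y = \<zero> \<longleftrightarrow> x = y"
  using assms by (metis a_minus_def a_inv_closed minus_equality minus_minus r_neg)

locale module_hom = M: module "polyring :: 'k::field mpoly4 ring" M + N: module "polyring :: 'k::field mpoly4 ring" N
  for M :: "('k::field mpoly4, 'm) grmod" and N :: "('k::field mpoly4, 'n) grmod" +
  fixes u
  assumes closed [simp, intro]: "x \<in> carrier M \<Longrightarrow> u x \<in> carrier N"
    and add: "x \<in> carrier M \<Longrightarrow> y \<in> carrier M \<Longrightarrow> u (x \<oplus>\<^bsub>M\<^esub> y) = u x \<oplus>\<^bsub>N\<^esub> u y"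
    and smult: "x \<in> carrier M \<Longrightarrow> u (r \<odot>\<^bsub>M\<^esub> x) = r \<odot>\<^bsub>N\<^esub> u x"
begin

lemma zero [simp]: "u \<zero>\<^bsub>M\<^esub> = \<zero>\<^bsub>N\<^esub>"
  by (metis M.zero_closed M.smult_l_null N.smult_l_null UNIV_I closed smult polyring_simps(1))

lemma minus: "x \<in> carrier M \<Longrightarrow> u (\<ominus>\<^bsub>M\<^esub> x) = \<ominus>\<^bsub>N\<^esub> u x"
  by (metis M.a_inv_closed M.r_neg N.minus_equality N.minus_minus add closed N.a_inv_closed N.add.inv_unique' zero)

lemma diff: "x \<in> carrier M \<Longrightarrow> y \<in> carrier M \<Longrightarrow> u (x \<ominus>\<^bsub>M\<^esub> y) = u x \<ominus>\<^bsub>N\<^esub> u y"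
  by (simp add: a_minus_def add minus)

end

lemma graded_hom_module_hom:
  assumes "u \<in> graded_hom M N" "module polyring M" "module polyring N"
  shows "module_hom M N u"
  using assms by (auto simp: graded_hom_def hom_def module_hom_def module_hom_axioms_def Pi_def)

lemma a_kernel_iff: "x \<in> a_kernel M N u \<longleftrightarrow> x \<in> carrier M \<and> u x = \<zero>\<^bsub>N\<^esub>"
  by (simp add: a_kernel_def kernel_def)

lemma submodule_Int:
  assumes "module polyring M" "submodule A polyring M" "submodule B polyring M"
  shows "submodule (A \<inter> B) polyring (M :: ('k::field mpoly4, 'm) grmod)"
proof -
  interpret module "polyring :: 'k mpoly4 ring" M by (rule assms)
  show ?thesis
    using submoduleE[OF assms(2)] submoduleE[OF assms(3)]
      subgroup.one_closed[OF submodule.axioms(1)[OF assms(2)]]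
      subgroup.one_closed[OF submodule.axioms(1)[OF assms(3)]]
    by (intro submoduleI) auto
qed

lemma (in module_hom) submodule_kernel: "submodule (a_kernel M N u) polyring M"
proof (rule M.submoduleI)
  fix x assume "x \<in> a_kernel M N u"
  then show "\<ominus>\<^bsub>M\<^esub> x \<in> a_kernel M N u"
    using N.M.minus_equality[of "\<zero>\<^bsub>N\<^esub>" "\<zero>\<^bsub>N\<^esub>"] by (simp add: a_kernel_iff minus)
qed (auto simp: a_kernel_iff add smult)

lemma (in module_hom) submodule_image:
  assumes "submodule A polyring M"
  shows "submodule (u ` A) polyring N"
proof (rule N.submoduleI)
  note A = M.submoduleE[OF assms] 
  show "u ` A \<subseteq> carrier N"
    using A(1) by auto
  show "\<zero>\<^bsub>N\<^esub> \<in> u ` A"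
    using subgroup.one_closed[OF submodule.axioms(1)[OF assms]] by (metis image_eqI monoid.simps(2) zero)
next
  note A = M.submoduleE[OF assms]
  fix y assume "y \<in> u ` A"
  then obtain x where x: "x \<in> A" "x \<in> carrier M" "y = u x"
    using A(1) by blast
  have "\<ominus>\<^bsub>N\<^esub> y = u (\<ominus>\<^bsub>M\<^esub> x)"
    using x by (simp add: minus)
  with A(3) x show "\<ominus>\<^bsub>N\<^esub> y \<in> u ` A" by blast
  show "r \<odot>\<^bsub>N\<^esub> y \<in> u ` A" for r
  proof -
    have "r \<odot>\<^bsub>N\<^esub> y = u (r \<odot>\<^bsub>M\<^esub> x)"
      using x by (simp add: smult)
    moreover have "r \<odot>\<^bsub>M\<^esub> x \<in> A"
      using A(4) x by simp
    ultimately show ?thesis by blast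
  qed
  fix z assume "z \<in> u ` A"
  then obtain x' where x': "x' \<in> A" "x' \<in> carrier M" "z = u x'"
    using A(1) by blast
  have "y \<oplus>\<^bsub>N\<^esub> z = u (x \<oplus>\<^bsub>M\<^esub> x')"
    using x x' by (simp add: add)
  with A(5) x x' show "y \<oplus>\<^bsub>N\<^esub> z \<in> u ` A" by blast
qed

lemma submodule_sub_grmod:
  fixes M :: "('k::field mpoly4, 'm) grmod"
  assumes M: "module polyring M" and AB: "submodule A polyring M" "submodule B polyring M" "A \<subseteq> B"
  shows "submodule A polyring (sub_grmod M B)"
proof -
  interpret module "polyring :: 'k mpoly4 ring" M by (rule M)
  have "subgroup A ((add_monoid M)\<lparr>carrier := B\<rparr>)"
    by (rule group.subgroup_incl[OF M.a_group submodule.axioms(1)[OF AB(1)] submodule.axioms(1)[OF AB(2)] AB(3)])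
  then show ?thesis
    using submodule.smult_closed[OF AB(1)]
    by (simp add: submodule_def submodule_axioms_def sub_grmod_def)
qed

lemma minus_sub_grmod:
  fixes M :: "('k::field mpoly4, 'm) grmod"
  assumes M: "module polyring M" and B: "submodule B polyring M" and y: "y \<in> B"
  shows "x \<ominus>\<^bsub>sub_grmod M B\<^esub> y = x \<ominus>\<^bsub>M\<^esub> y"
proof -
  interpret module "polyring :: 'k mpoly4 ring" M by (rule M)
  have "inv\<^bsub>(add_monoid M)\<lparr>carrier := B\<rparr>\<^esub> y = inv\<^bsub>add_monoid M\<^esub> y"
    by (rule group.m_inv_consistent[OF M.a_group submodule.axioms(1)[OF B] y])
  then show ?thesis
    by (simp add: a_minus_def a_inv_def sub_grmod_def)
qed


subsection \<open>Quotients\<close>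

locale module_quotient = M: module "polyring :: 'k::field mpoly4 ring" M
  for M :: "('k::field mpoly4, 'm) grmod" (structure) +
  fixes A
  assumes sub: "submodule A polyring M"
begin

sublocale S: abelian_subgroup A M
  by (intro abelian_subgroupI3 additive_subgroup.intro submodule.axioms(1)[OF sub] M.abelian_group_axioms)

lemma smult_A: "x \<in> A \<Longrightarrow> r \<odot> x \<in> A"
  using submodule.smult_closed[OF sub] by simp

lemma coset_eq_iff:
  assumes "x \<in> carrier M" "y \<in> carrier M"
  shows "A +> x = A +> y \<longleftrightarrow> x \<ominus> y \<in> A"
  using assms
  by (metis S.a_rcos_module S.a_rcos_self M.a_repr_independence S.a_subgroup a_minus_def)

lemma coset_smult:
  assumes x: "x \<in> carrier M"
  shows "(\<Union>y\<in>A +> x. A +> (r \<odot> y)) = A +> (r \<odot> x)"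
proof -
  have "A +> (r \<odot> y) = A +> (r \<odot> x)" if y: "y \<in> A +> x" for y
  proof -
    have yc: "y \<in> carrier M" "y \<ominus> x \<in> A"
      using y x S.a_elemrcos_carrier S.a_rcos_module unfolding a_minus_def by blast+
    have "r \<odot> (y \<ominus> x) = r \<odot> y \<ominus> r \<odot> x"
      using yc x by (simp add: a_minus_def M.smult_r_distr M.smult_r_minus)
    with smult_A[OF yc(2), of r] have "r \<odot> y \<ominus> r \<odot> x \<in> A"
      by simp
    then show ?thesis
      using coset_eq_iff[of "r \<odot> y" "r \<odot> x"] yc x by simp
  qed
  with S.a_rcos_self[OF x] show ?thesis by blast
qed

lemma quotient_simps:
  "carrier (quotient_grmod M A) = (\<lambda>x. A +> x) ` carrier M"
  "component (quotient_grmod M A) d = (\<lambda>x. A +> x) ` component M d"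
  "\<zero>\<^bsub>quotient_grmod M A\<^esub> = A"
  "x \<in> carrier M \<Longrightarrow> y \<in> carrier M \<Longrightarrow> (A +> x) \<oplus>\<^bsub>quotient_grmod M A\<^esub> (A +> y) = A +> (x \<oplus> y)"
  "x \<in> carrier M \<Longrightarrow> r \<odot>\<^bsub>quotient_grmod M A\<^esub> (A +> x) = A +> (r \<odot> x)"
  using S.a_rcos_sum coset_smult by (auto simp: quotient_grmod_def A_RCOSETS_def')

lemma coset_eq_A_iff:
  assumes x: "x \<in> carrier M"
  shows "A +> x = A \<longleftrightarrow> x \<in> A"
proof -
  have "\<ominus> \<zero> = \<zero>"
    by (metis M.M.l_neg M.M.r_zero M.M.zero_closed M.M.a_inv_closed)
  then have "x \<ominus> \<zero> = x"
    using x by (simp add: a_minus_def)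
  then show ?thesis
    using coset_eq_iff[of x \<zero>] M.a_coset_join2[of \<zero> A] S.a_subgroup S.zero_closed x by simp
qed

end

text \<open>If every element of \<open>N\<close> is congruent to an element of the image of \<open>u : M \<rightarrow> N\<close> modulo \<open>B\<close>, in
  every degree, then \<open>u\<close> induces an isomorphism \<open>M/u\<^bsup>-1\<^esup>(B) \<rightarrow> N/B\<close>. Its inverse sends a coset to its
  preimage under \<open>u\<close>, which makes it well-defined by construction.\<close>

lemma quotient_graded_isomorphic:
  fixes M :: "('k::field mpoly4, 'm) grmod" and N :: "('k mpoly4, 'n) grmod"
  assumes u: "module_hom M N u" and A: "submodule A polyring M" and B: "submodule B polyring N"
    and deg: "\<And>d x. x \<in> component M d \<Longrightarrow> u x \<in> component N d"
    and comp: "\<And>d. component M d \<subseteq> carrier M" "\<And>d. component N d \<subseteq> carrier N"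
    and pre: "\<And>x. x \<in> carrier M \<Longrightarrow> u x \<in> B \<longleftrightarrow> x \<in> A"
    and surj: "\<And>z. z \<in> carrier N \<Longrightarrow> \<exists>x\<in>carrier M. z \<ominus>\<^bsub>N\<^esub> u x \<in> B"
    and surj_deg: "\<And>d z. z \<in> component N d \<Longrightarrow> \<exists>x\<in>component M d. z \<ominus>\<^bsub>N\<^esub> u x \<in> B"
  shows "graded_isomorphic (quotient_grmod N B) (quotient_grmod M A)"
proof -
  interpret module_hom M N u by (rule u)
  interpret QM: module_quotient M A
    by (intro module_quotient.intro module_quotient_axioms.intro A M.module_axioms)
  interpret QN: module_quotient N B
    by (intro module_quotient.intro module_quotient_axioms.intro B N.module_axioms)
  define G where "G C = {x \<in> carrier M. u x \<in> C}" for C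
  have G: "G (B +>\<^bsub>N\<^esub> u x) = A +>\<^bsub>M\<^esub> x" if x: "x \<in> carrier M" for x
  proof -
    have "y \<in> G (B +>\<^bsub>N\<^esub> u x) \<longleftrightarrow> y \<in> A +>\<^bsub>M\<^esub> x" if y: "y \<in> carrier M" for y
    proof -
      have "y \<in> G (B +>\<^bsub>N\<^esub> u x) \<longleftrightarrow> u (y \<ominus>\<^bsub>M\<^esub> x) \<in> B"
        using x y QN.S.a_rcos_module[of "u x" "u y"] by (simp add: G_def diff a_minus_def add minus)
      also have "\<dots> \<longleftrightarrow> y \<ominus>\<^bsub>M\<^esub> x \<in> A"
        using pre x y by simp
      also have "\<dots> \<longleftrightarrow> y \<in> A +>\<^bsub>M\<^esub> x"
        using x y QM.S.a_rcos_module[of x y] by (simp add: a_minus_def)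
      finally show ?thesis .
    qed
    moreover have "A +>\<^bsub>M\<^esub> x \<subseteq> carrier M"
      using QM.S.a_elemrcos_carrier[OF x] by blast
    ultimately show ?thesis by (auto simp: G_def)
  qed
  have coset: "\<exists>x\<in>carrier M. B +>\<^bsub>N\<^esub> z = B +>\<^bsub>N\<^esub> u x" if "z \<in> carrier N" for z
    using surj[OF that] QN.coset_eq_iff[OF that] by fastforce
  have coset_deg: "\<exists>x\<in>component M d. B +>\<^bsub>N\<^esub> z = B +>\<^bsub>N\<^esub> u x" if "z \<in> component N d" for z d
    using surj_deg[OF that] QN.coset_eq_iff[of z] that comp by (meson closed subsetD)
  have car: "carrier (quotient_grmod N B) = (\<lambda>x. B +>\<^bsub>N\<^esub> u x) ` carrier M"
    using coset by (auto simp: QN.quotient_simps)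
  have cmp: "component (quotient_grmod N B) d = (\<lambda>x. B +>\<^bsub>N\<^esub> u x) ` component M d" for d
    using coset_deg deg unfolding QN.quotient_simps by (fast intro: rev_image_eqI)
  have Gcmp: "G ` component (quotient_grmod N B) d = component (quotient_grmod M A) d" for d
    using comp(1)[of d] G unfolding cmp QM.quotient_simps image_image by (intro image_cong) auto
  have Gcar: "G ` carrier (quotient_grmod N B) = carrier (quotient_grmod M A)"
    unfolding car QM.quotient_simps image_image using G by (intro image_cong) auto
  have "inj_on G (carrier (quotient_grmod N B))"
  proof (rule inj_onI)
    fix C D assume "C \<in> carrier (quotient_grmod N B)" "D \<in> carrier (quotient_grmod N B)" and eq: "G C = G D"
    then obtain x y where xy: "x \<in> carrier M" "C = B +>\<^bsub>N\<^esub> u x" "y \<in> carrier M" "D = B +>\<^bsub>N\<^esub> u y"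
      unfolding car by blast
    with eq G have "x \<ominus>\<^bsub>M\<^esub> y \<in> A"
      using QM.coset_eq_iff by metis
    with xy pre[of "x \<ominus>\<^bsub>M\<^esub> y"] have "u x \<ominus>\<^bsub>N\<^esub> u y \<in> B"
      by (simp add: diff)
    with xy show "C = D"
      using QN.coset_eq_iff[of "u x" "u y"] by simp
  qed
  moreover have "G \<in> graded_hom (quotient_grmod N B) (quotient_grmod M A)"
    unfolding graded_hom_def hom_def mem_Collect_eq
  proof (intro conjI ballI allI)
    show "G \<in> carrier (add_monoid (quotient_grmod N B)) \<rightarrow> carrier (add_monoid (quotient_grmod M A))"
      using Gcar by auto
  next
    fix C D assume "C \<in> carrier (add_monoid (quotient_grmod N B))" "D \<in> carrier (add_monoid (quotient_grmod N B))"
    then obtain x y where xy: "x \<in> carrier M" "C = B +>\<^bsub>N\<^esub> u x" "y \<in> carrier M" "D = B +>\<^bsub>N\<^esub> u y"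
      using car by auto
    then show "G (C \<otimes>\<^bsub>add_monoid (quotient_grmod N B)\<^esub> D)
      = G C \<otimes>\<^bsub>add_monoid (quotient_grmod M A)\<^esub> G D"
      using G by (simp add: QN.quotient_simps QM.quotient_simps flip: add)
  next
    fix r C assume "C \<in> carrier (quotient_grmod N B)"
    then obtain x where x: "x \<in> carrier M" "C = B +>\<^bsub>N\<^esub> u x"
      using car by auto
    then show "G (r \<odot>\<^bsub>quotient_grmod N B\<^esub> C) = r \<odot>\<^bsub>quotient_grmod M A\<^esub> G C"
      using G by (simp add: QN.quotient_simps QM.quotient_simps flip: smult)
  next
    fix d show "G ` component (quotient_grmod N B) d \<subseteq> component (quotient_grmod M A) d"
      using Gcmp by simp
  qed
  ultimately show ?thesis
    unfolding graded_isomorphic_def bij_betw_def using Gcar Gcmp by blast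
qed


subsection \<open>The polynomial ring as a module over itself\<close>

lemma regular_module_simps [simp]:
  "carrier regular_module = (UNIV :: 'k::field mpoly4 set)"
  "\<zero>\<^bsub>regular_module\<^esub> = (0 :: 'k mpoly4)"
  "p \<oplus>\<^bsub>regular_module\<^esub> q = (p + q :: 'k mpoly4)"
  "r \<odot>\<^bsub>regular_module\<^esub> p = (r * p :: 'k mpoly4)"
  "component regular_module d = (homogeneous d :: 'k mpoly4 set)"
  by (simp_all add: regular_module_def)

lemma module_regular_module: "module polyring (regular_module :: ('k::field mpoly4, _) grmod)"
proof (rule moduleI)
  show "abelian_group (regular_module :: ('k mpoly4, _) grmod)"
    by (rule abelian_groupI) (auto simp: algebra_simps intro: exI[of _ "- _"])
qed (auto simp: cring_polyring algebra_simps)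

lemma minus_regular_module [simp]:
  "p \<ominus>\<^bsub>regular_module\<^esub> q = (p - q :: 'k::field mpoly4)"
proof -
  interpret module "polyring :: 'k mpoly4 ring" "regular_module :: ('k mpoly4, _) grmod"
    by (rule module_regular_module)
  have "\<ominus>\<^bsub>regular_module\<^esub> q = - q"
    by (rule M.minus_equality) auto
  then show ?thesis by (simp add: a_minus_def)
qed

lemma submodule_monomial_span:
  assumes "upset T"
  shows "submodule (monomial_span T) polyring (regular_module :: ('k::field mpoly4, _) grmod)"
proof -
  interpret module "polyring :: 'k mpoly4 ring" "regular_module :: ('k mpoly4, _) grmod"
    by (rule module_regular_module)
  show ?thesis
  proof (rule submoduleI)
    fix p :: "'k mpoly4" assume "p \<in> monomial_span T"
    moreover have "\<ominus>\<^bsub>regular_module\<^esub> p = - p"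
      by (rule M.minus_equality) auto
    ultimately show "\<ominus>\<^bsub>regular_module\<^esub> p \<in> monomial_span T"
      by (simp add: monomial_span_uminus)
  qed (auto simp: monomial_span_add monomial_span_mult[OF assms])
qed

lemma set_add_monomial_span:
  "monomial_span S <+>\<^bsub>regular_module\<^esub> monomial_span T = (monomial_span (S \<union> T) :: 'k::field mpoly4 set)"
proof (intro antisym subsetI)
  fix p :: "'k mpoly4" assume "p \<in> monomial_span (S \<union> T)"
  then have "p - restrict_to T p \<in> monomial_span S" "restrict_to T p \<in> monomial_span T"
    by (rule restrict_to_complement, rule restrict_to_in_span)
  moreover have "p = (p - restrict_to T p) + restrict_to T p"
    by simp
  ultimately show "p \<in> monomial_span S <+>\<^bsub>regular_module\<^esub> monomial_span T"
    unfolding set_add_def' regular_module_simps by blast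
qed (auto simp: set_add_def' monomial_span_iff lookup_add)


section \<open>Homogeneous components\<close>

definition proj :: "('k::field mpoly4, 'm) grmod \<Rightarrow> int \<Rightarrow> 'm \<Rightarrow> 'm" where
  "proj M d x = (THE c. (\<forall>d. c d \<in> component M d) \<and> finite {d. c d \<noteq> \<zero>\<^bsub>M\<^esub>} \<and>
     x = (\<Oplus>\<^bsub>M\<^esub>d\<in>{d. c d \<noteq> \<zero>\<^bsub>M\<^esub>}. c d)) d"

context graded_module
begin

lemma component_carrier: "component M d \<subseteq> carrier M"
  using subgroup.subset[OF component_subgroup] by simp

lemma component_zero: "\<zero> \<in> component M d"
  using subgroup.one_closed[OF component_subgroup] by simp

lemma component_add: "x \<in> component M d \<Longrightarrow> y \<in> component M d \<Longrightarrow> x \<oplus> y \<in> component M d"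
  using subgroup.m_closed[OF component_subgroup] by simp

lemma proj_eqI:
  assumes c: "\<And>d. c d \<in> component M d" and F: "finite F" "\<And>d. d \<notin> F \<Longrightarrow> c d = \<zero>"
    and x: "x = (\<Oplus>d\<in>F. c d)"
  shows "proj M d x = c d"
proof -
  have cc: "c d \<in> carrier M" for d
    using c component_carrier by blast
  have supp: "{d. c d \<noteq> \<zero>} \<subseteq> F"
    using F(2) by blast
  have "x = (\<Oplus>d\<in>{d. c d \<noteq> \<zero>}. c d)"
    unfolding x by (rule M.add.finprod_mono_neutral_cong_right[OF F(1) supp]) (use cc in auto)
  moreover have "x \<in> carrier M"
    unfolding x using cc by (intro M.finsum_closed) auto
  ultimately have "(THE c. (\<forall>d. c d \<in> component M d) \<and> finite {d. c d \<noteq> \<zero>} \<and>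
     x = (\<Oplus>d\<in>{d. c d \<noteq> \<zero>}. c d)) = c"
    using c finite_subset[OF supp F(1)] by (intro the1_equality decomposition) auto
  then show ?thesis by (simp add: proj_def)
qed

lemma proj_decomposition:
  assumes x: "x \<in> carrier M"
  shows "proj M d x \<in> component M d" and "finite {d. proj M d x \<noteq> \<zero>}"
    and "x = (\<Oplus>d\<in>{d. proj M d x \<noteq> \<zero>}. proj M d x)"
proof -
  have "(\<forall>d. proj M d x \<in> component M d) \<and> finite {d. proj M d x \<noteq> \<zero>} \<and>
     x = (\<Oplus>d\<in>{d. proj M d x \<noteq> \<zero>}. proj M d x)"
    using theI'[OF decomposition[OF x]] unfolding proj_def .
  then show "proj M d x \<in> component M d" and "finite {d. proj M d x \<noteq> \<zero>}"
    and "x = (\<Oplus>d\<in>{d. proj M d x \<noteq> \<zero>}. proj M d x)"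
    by blast+
qed

lemma proj_carrier [simp, intro]: "x \<in> carrier M \<Longrightarrow> proj M d x \<in> carrier M"
  using proj_decomposition(1) component_carrier by blast

lemma proj_component:
  assumes x: "x \<in> component M d"
  shows "proj M d x = x"
proof -
  have "x \<in> carrier M"
    using x component_carrier by blast
  then have "proj M d x = (if d = d then x else \<zero>)"
    using x component_zero by (intro proj_eqI[where F = "{d}"]) auto
  then show ?thesis by simp
qed

lemma proj_add:
  assumes x: "x \<in> carrier M" and y: "y \<in> carrier M"
  shows "proj M d (x \<oplus> y) = proj M d x \<oplus> proj M d y"
proof (rule proj_eqI[where F = "{d. proj M d x \<noteq> \<zero>} \<union> {d. proj M d y \<noteq> \<zero>}"])
  let ?F = "{d. proj M d x \<noteq> \<zero>} \<union> {d. proj M d y \<noteq> \<zero>}"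
  have fin: "finite ?F"
    using proj_decomposition(2) x y by blast
  have "x = (\<Oplus>d\<in>?F. proj M d x)"
    by (subst proj_decomposition(3)[OF x], rule M.add.finprod_mono_neutral_cong_left[OF fin])
       (use x in auto)
  moreover have "y = (\<Oplus>d\<in>?F. proj M d y)"
    by (subst proj_decomposition(3)[OF y], rule M.add.finprod_mono_neutral_cong_left[OF fin])
       (use y in auto)
  ultimately show "x \<oplus> y = (\<Oplus>d\<in>?F. proj M d x \<oplus> proj M d y)"
    using x y by (subst M.finsum_addf) auto
qed (use x y component_add proj_decomposition in auto)

end

text \<open>Additive maps of a fixed degree \<open>k\<close> commute with taking homogeneous components. Multiplication by
  a homogeneous polynomial is such a map (\<open>k\<close> is its degree), and so is a graded homomorphism
  (\<open>k = 0\<close>).\<close>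

lemma proj_additive_shift:
  fixes M :: "('k::field mpoly4, 'm) grmod" and N :: "('k mpoly4, 'n) grmod"
  assumes M: "graded_module M" and N: "graded_module N"
    and u: "u \<in> hom (add_monoid M) (add_monoid N)"
    and deg: "\<And>d x. x \<in> component M d \<Longrightarrow> u x \<in> component N (k + d)"
    and x: "x \<in> carrier M"
  shows "proj N (k + d) (u x) = u (proj M d x)"
proof -
  interpret M: graded_module M by (rule M)
  interpret N: graded_module N by (rule N)
  have car: "u y \<in> carrier N" if "y \<in> carrier M" for y
    using u that by (auto simp: hom_def)
  have add: "u (y \<oplus>\<^bsub>M\<^esub> z) = u y \<oplus>\<^bsub>N\<^esub> u z" if "y \<in> carrier M" "z \<in> carrier M" for y z
    using u that by (auto simp: hom_def)
  interpret H: group_hom "add_monoid M" "add_monoid N" u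
    using M.M.a_group N.M.a_group u by (simp add: group_hom_def group_hom_axioms_def)
  have zero: "u \<zero>\<^bsub>M\<^esub> = \<zero>\<^bsub>N\<^esub>"
    using H.hom_one by simp
  let ?F = "{d. proj M d x \<noteq> \<zero>\<^bsub>M\<^esub>}"
  have "finite G \<Longrightarrow> u (finsum M (\<lambda>d. proj M d x) G) = finsum N (\<lambda>d. u (proj M d x)) G" for G
    by (induction G rule: finite_induct) (use x in \<open>auto simp: add zero car Pi_def\<close>)
  then have "u x = finsum N (\<lambda>d. u (proj M d x)) ?F"
    using M.proj_decomposition[OF x] by metis
  also have "\<dots> = finsum N (\<lambda>e. u (proj M (e - k) x)) ((+) k ` ?F)"
    by (subst N.M.finsum_reindex) (use x car in \<open>auto simp: inj_on_def\<close>)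
  finally have "u x = finsum N (\<lambda>e. u (proj M (e - k) x)) ((+) k ` ?F)" .
  then have "proj N (k + d) (u x) = u (proj M (k + d - k) x)"
  proof (rule N.proj_eqI[where c = "\<lambda>e. u (proj M (e - k) x)" and F = "(+) k ` ?F", rotated -1])
    show "u (proj M (e - k) x) \<in> component N e" for e
      using deg[OF M.proj_decomposition(1)[OF x, of "e - k"]] by simp
    show "finite ((+) k ` ?F)"
      using M.proj_decomposition(2)[OF x] by simp
    show "u (proj M (e - k) x) = \<zero>\<^bsub>N\<^esub>" if "e \<notin> (+) k ` ?F" for e
    proof -
      have "e - k \<notin> ?F"
        using that by (metis add.commute diff_add_cancel image_eqI)
      then show ?thesis by (simp add: zero)
    qed
  qed
  then show ?thesis by simp
qed

lemma proj_graded_hom: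
  assumes "graded_module M" "graded_module N" "u \<in> graded_hom M N" "x \<in> carrier M"
  shows "proj N d (u x) = u (proj M d x)"
  using proj_additive_shift[of M N u 0 x d] assms by (simp add: graded_hom_def image_subset_iff)

lemma proj_smult:
  assumes M: "graded_module M" and r: "r \<in> homogeneous k" and x: "x \<in> carrier M"
  shows "proj M (k + d) (r \<odot>\<^bsub>M\<^esub> x) = r \<odot>\<^bsub>M\<^esub> proj M d x"
proof -
  interpret graded_module M by (rule M)
  show ?thesis
    by (rule proj_additive_shift[OF M M _ _ x])
       (use r component_smult in \<open>auto simp: hom_def smult_r_distr\<close>)
qed


subsection \<open>Extending homomorphisms from monomial ideals\<close>

text \<open>Graded injectivity concerns modules whose elements are sets of finitely supported sequences of
  polynomials. To apply it to ideals, \<open>p\<close> is represented by the singleton of the sequence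
  \<open>(p, 0, 0, \<dots>)\<close>.\<close>

definition encode :: "'k::field mpoly4 \<Rightarrow> (nat \<Rightarrow>\<^sub>0 'k mpoly4) set" where
  "encode p = {Poly_Mapping.single 0 p}"

definition decode :: "(nat \<Rightarrow>\<^sub>0 'k::field mpoly4) set \<Rightarrow> 'k mpoly4" where
  "decode Z = Poly_Mapping.lookup (the_elem Z) 0"

lemma decode_encode [simp]: "decode (encode p) = p"
  by (simp add: decode_def encode_def)

lemma encode_eq_iff [simp]: "encode p = encode q \<longleftrightarrow> p = q"
  by (metis decode_encode)

definition ideal_copy :: "expo set \<Rightarrow> ('k::field mpoly4, (nat \<Rightarrow>\<^sub>0 'k mpoly4) set) grmod" where
  "ideal_copy T = \<lparr>carrier = encode ` monomial_span T, monoid.mult = undefined, one = undefined,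
     ring.zero = encode 0, add = (\<lambda>Z Y. encode (decode Z + decode Y)),
     module.smult = (\<lambda>r Z. encode (r * decode Z)),
     component = (\<lambda>d. encode ` (homogeneous d \<inter> monomial_span T))\<rparr>"

lemma ideal_copy_simps [simp]:
  "carrier (ideal_copy T) = encode ` monomial_span T"
  "\<zero>\<^bsub>ideal_copy T\<^esub> = encode 0"
  "Z \<oplus>\<^bsub>ideal_copy T\<^esub> Y = encode (decode Z + decode Y)"
  "r \<odot>\<^bsub>ideal_copy T\<^esub> Z = encode (r * decode Z)"
  "component (ideal_copy T) d = encode ` (homogeneous d \<inter> monomial_span T)"
  by (simp_all add: ideal_copy_def)

lemma homogeneous_iff: "p \<in> homogeneous d \<longleftrightarrow> (\<forall>y. coef p y \<noteq> 0 \<longrightarrow> int (total_degree y) = d)"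
  by (auto simp: homogeneous_def in_keys_iff)

lemma homogeneous_zero: "0 \<in> homogeneous d"
  and homogeneous_add: "p \<in> homogeneous d \<Longrightarrow> q \<in> homogeneous d \<Longrightarrow> p + q \<in> homogeneous d"
  and homogeneous_uminus: "p \<in> homogeneous d \<Longrightarrow> - p \<in> homogeneous d"
proof -
  show "p \<in> homogeneous d \<Longrightarrow> q \<in> homogeneous d \<Longrightarrow> p + q \<in> homogeneous d"
    unfolding homogeneous_def using keys_add[of p q] by blast
qed (auto simp: homogeneous_iff)

lemma total_degree_add: "total_degree (y + z) = total_degree y + total_degree z"
  by (simp add: total_degree_def)

lemma homogeneous_mult:
  fixes p q :: "'k::field mpoly4"
  assumes "p \<in> homogeneous i" "q \<in> homogeneous j"
  shows "p * q \<in> homogeneous (i + j)"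
  using assms unfolding homogeneous_def
  by (fastforce elim!: keys_mult_subset simp: total_degree_add)

lemma module_ideal_copy:
  fixes T :: "expo set"
  assumes T: "upset T"
  shows "module polyring (ideal_copy T :: ('k::field mpoly4, _) grmod)"
proof (rule moduleI)
  show "abelian_group (ideal_copy T :: ('k mpoly4, _) grmod)"
  proof (rule abelian_groupI)
    fix Z :: "(nat \<Rightarrow>\<^sub>0 'k mpoly4) set" assume "Z \<in> carrier (ideal_copy T)"
    then obtain p where "Z = encode p" "p \<in> monomial_span T" by auto
    then show "\<exists>Y\<in>carrier (ideal_copy T). Y \<oplus>\<^bsub>ideal_copy T\<^esub> Z = \<zero>\<^bsub>ideal_copy T\<^esub>"
      by (auto intro!: bexI[of _ "- p"] monomial_span_uminus)
  qed (auto simp: algebra_simps intro!: monomial_span_add imageI)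
qed (auto simp: cring_polyring algebra_simps intro!: imageI monomial_span_mult[OF T])

definition homogeneous_part :: "int \<Rightarrow> 'k::field mpoly4 \<Rightarrow> 'k mpoly4" where
  "homogeneous_part d = restrict_to {y. int (total_degree y) = d}"

lemma homogeneous_part_homogeneous: "homogeneous_part d p \<in> homogeneous d"
  by (auto simp: homogeneous_iff homogeneous_part_def lookup_restrict_to when_def)

lemma homogeneous_part_span: "p \<in> monomial_span T \<Longrightarrow> homogeneous_part d p \<in> monomial_span T"
  by (auto simp: monomial_span_iff homogeneous_part_def lookup_restrict_to when_def)

lemma finsum_ideal_copy:
  assumes T: "upset T" and F: "finite F" and c: "\<And>d. c d \<in> monomial_span T"
  shows "finsum (ideal_copy T) (\<lambda>d. encode (c d)) F = encode (\<Sum>d\<in>F. c d)"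
proof -
  interpret module "polyring :: 'k mpoly4 ring" "ideal_copy T :: ('k::field mpoly4, _) grmod"
    by (rule module_ideal_copy[OF T])
  show ?thesis
    using F c by (induction F rule: finite_induct) (auto simp: Pi_def)
qed

lemma
  fixes p :: "'k::field mpoly4"
  shows finite_homogeneous_parts: "finite {d. homogeneous_part d p \<noteq> 0}"
    and sum_homogeneous_parts: "p = (\<Sum>d | homogeneous_part d p \<noteq> 0. homogeneous_part d p)"
proof -
  have nz: "homogeneous_part (int (total_degree y)) p \<noteq> 0" if "coef p y \<noteq> 0" for y
  proof
    assume "homogeneous_part (int (total_degree y)) p = 0"
    then have "coef (homogeneous_part (int (total_degree y)) p) y = 0" by simp
    with that show False by (simp add: homogeneous_part_def lookup_restrict_to)
  qed
  have "{d. homogeneous_part d p \<noteq> 0} \<subseteq> (\<lambda>y. int (total_degree y)) ` Poly_Mapping.keys p"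
  proof
    fix d assume "d \<in> {d. homogeneous_part d p \<noteq> 0}"
    then have "Poly_Mapping.keys (homogeneous_part d p) \<noteq> {}"
      by simp
    then obtain y where "coef (homogeneous_part d p) y \<noteq> 0"
      by (meson ex_in_conv in_keys_iff)
    then show "d \<in> (\<lambda>y. int (total_degree y)) ` Poly_Mapping.keys p"
      by (auto simp: homogeneous_part_def lookup_restrict_to when_def in_keys_iff split: if_splits)
  qed
  then show fin: "finite {d. homogeneous_part d p \<noteq> 0}"
    by (rule finite_subset) simp
  show "p = (\<Sum>d | homogeneous_part d p \<noteq> 0. homogeneous_part d p)"
  proof (rule poly_mapping_eqI)
    fix y
    have "coef (\<Sum>d | homogeneous_part d p \<noteq> 0. homogeneous_part d p) y
      = (\<Sum>d | homogeneous_part d p \<noteq> 0. if d = int (total_degree y) then coef p y else 0)"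
      by (auto simp: lookup_sum homogeneous_part_def lookup_restrict_to when_def intro!: sum.cong)
    also have "\<dots> = coef p y"
      using fin nz[of y] by auto
    finally show "coef p y = coef (\<Sum>d | homogeneous_part d p \<noteq> 0. homogeneous_part d p) y" ..
  qed
qed

lemma ideal_copy_decomposition:
  fixes p :: "'k::field mpoly4"
  assumes T: "upset T" and p: "p \<in> monomial_span T"
  shows "encode (homogeneous_part d p) \<in> component (ideal_copy T) d"
    and "finite {d. homogeneous_part d p \<noteq> 0}"
    and "encode p = (\<Oplus>\<^bsub>ideal_copy T\<^esub>d\<in>{d. homogeneous_part d p \<noteq> 0}. encode (homogeneous_part d p))"
proof -
  show "encode (homogeneous_part d p) \<in> component (ideal_copy T) d"
    using homogeneous_part_homogeneous homogeneous_part_span[OF p] unfolding ideal_copy_simps by blast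
  show "finite {d. homogeneous_part d p \<noteq> 0}"
    by (rule finite_homogeneous_parts)
  show "encode p = (\<Oplus>\<^bsub>ideal_copy T\<^esub>d\<in>{d. homogeneous_part d p \<noteq> 0}. encode (homogeneous_part d p))"
    by (subst finsum_ideal_copy[OF T finite_homogeneous_parts homogeneous_part_span[OF p]])
       (rule arg_cong[OF sum_homogeneous_parts])
qed

lemma homogeneous_part_unique:
  assumes "finite F" "\<And>d. c d \<in> homogeneous d" "\<And>d. d \<notin> F \<Longrightarrow> c d = 0"
  shows "homogeneous_part e (\<Sum>d\<in>F. c d) = c e"
proof (rule poly_mapping_eqI)
  fix y
  have "coef (c d) y = (if d = int (total_degree y) then coef (c d) y else 0)" for d
    using assms(2)[of d] by (auto simp: homogeneous_iff)
  then have "(\<Sum>d\<in>F. coef (c d) y) = (\<Sum>d\<in>F. if d = int (total_degree y) then coef (c d) y else 0)"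
    by (intro sum.cong) auto
  also have "\<dots> = coef (c (int (total_degree y))) y"
    using assms(1,3) by auto
  finally show "coef (homogeneous_part e (\<Sum>d\<in>F. c d)) y = coef (c e) y"
    using assms(2)[of e] by (auto simp: homogeneous_part_def lookup_restrict_to when_def lookup_sum homogeneous_iff)
qed

lemma graded_module_ideal_copy:
  assumes T: "upset T"
  shows "graded_module (ideal_copy T :: ('k::field mpoly4, _) grmod)"
proof -
  interpret module "polyring :: 'k mpoly4 ring" "ideal_copy T :: ('k mpoly4, _) grmod"
    by (rule module_ideal_copy[OF T])
  show ?thesis
  proof (intro graded_module.intro graded_module_axioms.intro)
    show "module polyring (ideal_copy T :: ('k mpoly4, _) grmod)"
      by (rule module_axioms)
  next
    fix d
    show "subgroup (component (ideal_copy T :: ('k mpoly4, _) grmod) d) (add_monoid (ideal_copy T))"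
    proof (rule M.add.subgroupI, goal_cases)
      case 1
      show ?case by auto
    next
      case 2
      have "encode 0 \<in> component (ideal_copy T :: ('k mpoly4, _) grmod) d"
        by (simp add: homogeneous_zero)
      then show ?case by blast
    next
      case (3 Z)
      then obtain p where p: "Z = encode p" "p \<in> homogeneous d \<inter> monomial_span T"
        by auto
      have "\<ominus>\<^bsub>ideal_copy T\<^esub> Z = encode (- p)"
        using p by (intro M.minus_equality) (auto intro!: monomial_span_uminus imageI)
      with p show ?case
        by (auto intro!: homogeneous_uminus monomial_span_uminus)
    next
      case (4 Y Z)
      then show ?case
        by (auto intro!: homogeneous_add monomial_span_add)
    qed
  next
    fix Z :: "(nat \<Rightarrow>\<^sub>0 'k mpoly4) set" assume "Z \<in> carrier (ideal_copy T)"
    then obtain p where p: "Z = encode p" "p \<in> monomial_span T" by auto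
    show "\<exists>!c. (\<forall>d. c d \<in> component (ideal_copy T) d) \<and> finite {d. c d \<noteq> \<zero>\<^bsub>ideal_copy T\<^esub>} \<and>
           Z = (\<Oplus>\<^bsub>ideal_copy T\<^esub>d\<in>{d. c d \<noteq> \<zero>\<^bsub>ideal_copy T\<^esub>}. c d)"
    proof (rule ex1I[of _ "\<lambda>d. encode (homogeneous_part d p)"], goal_cases)
      case 1
      show ?case
        using ideal_copy_decomposition[OF T p(2)] by (simp add: p(1))
    next
      case (2 c)
      define b where "b = (\<lambda>d. decode (c d))"
      have b: "c d = encode (b d)" "b d \<in> homogeneous d" "b d \<in> monomial_span T" for d
      proof -
        obtain q where "c d = encode q" "q \<in> homogeneous d" "q \<in> monomial_span T"
          using 2 by auto
        then show "c d = encode (b d)" "b d \<in> homogeneous d" "b d \<in> monomial_span T"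
          by (simp_all add: b_def)
      qed
      have fin: "finite {d. b d \<noteq> 0}"
        using 2 by (simp add: b(1))
      have "encode p = encode (\<Sum>d | b d \<noteq> 0. b d)"
        using 2 finsum_ideal_copy[OF T fin, of b] b(3) by (simp add: b(1) p)
      then have "p = (\<Sum>d | b d \<noteq> 0. b d)"
        by simp
      then have "homogeneous_part d p = b d" for d
        using homogeneous_part_unique[OF fin b(2), of d] by simp
      with b(1) show ?case
        by (simp add: fun_eq_iff)
    qed
  next
    fix i j and r :: "'k mpoly4" and Z :: "(nat \<Rightarrow>\<^sub>0 'k mpoly4) set"
    assume "r \<in> homogeneous i" "Z \<in> component (ideal_copy T) j"
    then show "r \<odot>\<^bsub>ideal_copy T\<^esub> Z \<in> component (ideal_copy T) (i + j)"
      by (auto intro!: imageI homogeneous_mult monomial_span_mult[OF T])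
  qed
qed

lemma proj_ideal_copy:
  assumes T: "upset T" and p: "p \<in> monomial_span T"
  shows "proj (ideal_copy T) d (encode p) = encode (homogeneous_part d p)"
proof -
  interpret graded_module "ideal_copy T :: ('k::field mpoly4, _) grmod"
    by (rule graded_module_ideal_copy[OF T])
  show ?thesis
    using ideal_copy_decomposition[OF T p]
    by (intro proj_eqI[where F = "{d. homogeneous_part d p \<noteq> 0}"]) auto
qed

lemma sub_grmod_ideal_copy:
  "sub_grmod (ideal_copy UNIV) (encode ` monomial_span T) = (ideal_copy T :: ('k::field mpoly4, _) grmod)"
proof -
  have "inj (encode :: 'k mpoly4 \<Rightarrow> _)"
    by (rule injI) simp
  then show ?thesis
    by (simp add: sub_grmod_def ideal_copy_def image_Int)
qed

text \<open>Graded injectivity, applied to the inclusion of the copy of \<open>K[T]\<close> into that of \<open>R\<close>.\<close>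

lemma graded_injective_extend:
  fixes E :: "('k::field mpoly4, 'e) grmod" and f :: "'k mpoly4 \<Rightarrow> 'e"
  assumes E: "graded_injective E" and T: "upset T"
    and f: "\<And>p. p \<in> monomial_span T \<Longrightarrow> f p \<in> carrier E"
      "\<And>p q. p \<in> monomial_span T \<Longrightarrow> q \<in> monomial_span T \<Longrightarrow> f (p + q) = f p \<oplus>\<^bsub>E\<^esub> f q"
      "\<And>r p. p \<in> monomial_span T \<Longrightarrow> f (r * p) = r \<odot>\<^bsub>E\<^esub> f p"
      "\<And>d p. p \<in> monomial_span T \<Longrightarrow> p \<in> homogeneous d \<Longrightarrow> f p \<in> component E d"
  obtains g where "g \<in> graded_hom (ideal_copy UNIV) E"
    "\<And>p. p \<in> monomial_span T \<Longrightarrow> g (encode p) = f p"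
proof -
  interpret module "polyring :: 'k mpoly4 ring" "ideal_copy UNIV :: ('k mpoly4, _) grmod"
    by (rule module_ideal_copy[OF upset_UNIV])
  let ?A = "encode ` (monomial_span T :: 'k mpoly4 set)"
  have "submodule ?A polyring (ideal_copy UNIV)"
  proof (rule submoduleI)
    fix Z assume "Z \<in> ?A"
    then obtain p where p: "Z = encode p" "p \<in> monomial_span T" by auto
    have "\<ominus>\<^bsub>ideal_copy UNIV\<^esub> Z = encode (- p)"
      using p by (intro M.minus_equality) auto
    with p show "\<ominus>\<^bsub>ideal_copy UNIV\<^esub> Z \<in> ?A"
      by (auto intro!: monomial_span_uminus)
  qed (auto intro!: imageI monomial_span_add monomial_span_mult[OF T])
  then have "graded_submodule ?A (ideal_copy UNIV)"
    by (simp add: graded_submodule_def sub_grmod_ideal_copy graded_module_ideal_copy[OF T])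
  moreover have "f \<circ> decode \<in> graded_hom (sub_grmod (ideal_copy UNIV) ?A) E"
    using f by (auto simp: sub_grmod_ideal_copy graded_hom_def hom_def)
  ultimately obtain g where "g \<in> graded_hom (ideal_copy UNIV) E" "\<forall>Z\<in>?A. g Z = (f \<circ> decode) Z"
    using E graded_module_ideal_copy[OF upset_UNIV] unfolding graded_injective_def by blast
  then show thesis
    by (intro that[of g]) auto
qed


section \<open>Torsion\<close>

text \<open>A monomial of degree at least \<open>4n\<close> in four variables is divisible by some \<open>x\<^sub>v\<^sup>n\<close>, so being killed by
  a power of \<open>\<mm>\<close> amounts to being killed by a power of each variable.\<close>

lemma torsion_iff:
  fixes M :: "('k::field mpoly4, 'm) grmod"
  assumes "module polyring M"
  shows "x \<in> \<Gamma>\<^sub>\<mm> M \<longleftrightarrow> x \<in> carrier M \<and> (\<exists>n. \<forall>v. var_power v n \<odot>\<^bsub>M\<^esub> x = \<zero>\<^bsub>M\<^esub>)"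
proof -
  interpret module "polyring :: 'k mpoly4 ring" M by (rule assms)
  show ?thesis
  proof safe
    assume "x \<in> \<Gamma>\<^sub>\<mm> M"
    then obtain n where x: "x \<in> carrier M"
      and n: "\<And>r. r \<in> monomial_span {y. n \<le> total_degree y} \<Longrightarrow> r \<odot>\<^bsub>M\<^esub> x = \<zero>\<^bsub>M\<^esub>"
      unfolding torsion_def ideal_power_max_ideal by blast
    show "x \<in> carrier M" by (rule x)
    have "(var_power v n :: 'k mpoly4) \<in> monomial_span {y. n \<le> total_degree y}" for v
      by (cases v) (auto simp: var_power_def monomial_span_def total_degree_def coord_single)
    with n show "\<exists>n. \<forall>v. var_power v n \<odot>\<^bsub>M\<^esub> x = \<zero>\<^bsub>M\<^esub>" by blast
  next
    fix n assume x: "x \<in> carrier M" and n: "\<forall>v. var_power v n \<odot>\<^bsub>M\<^esub> x = \<zero>\<^bsub>M\<^esub>"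
    have "r \<odot>\<^bsub>M\<^esub> x = \<zero>\<^bsub>M\<^esub>" if "r \<in> monomial_span {y. 4 * n \<le> total_degree y}" for r
      using that
    proof (induction r rule: monomial_span_induct)
      case zero
      show ?case using smult_l_null[OF x] by simp
    next
      case (add p q)
      then show ?case using smult_l_distr[of p q x] x by simp
    next
      case (single y c)
      have "\<exists>v. n \<le> coord y v"
      proof (rule ccontr)
        assume "\<nexists>v. n \<le> coord y v"
        then have "coord y v < n" for v by (simp add: not_le)
        from this[of X1] this[of X2] this[of X3] this[of X4] single show False
          by (simp add: total_degree_def)
      qed
      then obtain v where v: "n \<le> coord y v" ..
      then show ?case
        using smult_assoc1[of "Poly_Mapping.single (y - Poly_Mapping.single v n) c" "var_power v n" x] n x
        by (simp add: single_split[OF v])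
    qed
    with x show "x \<in> \<Gamma>\<^sub>\<mm> M"
      unfolding torsion_def ideal_power_max_ideal by blast
  qed
qed

lemma var_power_smult_mono:
  fixes M :: "('k::field mpoly4, 'm) grmod"
  assumes "module polyring M" "x \<in> carrier M" "var_power v n \<odot>\<^bsub>M\<^esub> x = \<zero>\<^bsub>M\<^esub>" "n \<le> m"
  shows "var_power v m \<odot>\<^bsub>M\<^esub> x = \<zero>\<^bsub>M\<^esub>"
proof -
  interpret module "polyring :: 'k mpoly4 ring" M by (rule assms)
  have "var_power v m = (var_power v (m - n) * var_power v n :: 'k mpoly4)"
    using assms by (simp add: var_power_mult)
  then show ?thesis
    using smult_assoc1[of "var_power v (m - n)" "var_power v n" x] assms by simp
qed

lemma submodule_torsion:
  fixes M :: "('k::field mpoly4, 'm) grmod"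
  assumes M: "module polyring M"
  shows "submodule (\<Gamma>\<^sub>\<mm> M) polyring M"
proof -
  interpret module "polyring :: 'k mpoly4 ring" M by (rule M)
  note iff = torsion_iff[OF M]
  show ?thesis
  proof (rule submoduleI)
    show "\<Gamma>\<^sub>\<mm> M \<subseteq> carrier M"
      using iff by blast
    show "\<zero>\<^bsub>M\<^esub> \<in> \<Gamma>\<^sub>\<mm> M"
      by (simp add: iff)
  next
    fix x assume "x \<in> \<Gamma>\<^sub>\<mm> M"
    then obtain n where x: "x \<in> carrier M" "\<And>v. var_power v n \<odot>\<^bsub>M\<^esub> x = \<zero>\<^bsub>M\<^esub>"
      using iff by blast
    then have "var_power v n \<odot>\<^bsub>M\<^esub> (\<ominus>\<^bsub>M\<^esub> x) = \<zero>\<^bsub>M\<^esub>" for v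
      using smult_r_minus[of "var_power v n" x] M.minus_equality[of "\<zero>\<^bsub>M\<^esub>" "\<zero>\<^bsub>M\<^esub>"] by simp
    with x show "\<ominus>\<^bsub>M\<^esub> x \<in> \<Gamma>\<^sub>\<mm> M"
      unfolding iff by auto
  next
    fix x y assume "x \<in> \<Gamma>\<^sub>\<mm> M" "y \<in> \<Gamma>\<^sub>\<mm> M"
    then obtain m n where x: "x \<in> carrier M" "\<And>v. var_power v m \<odot>\<^bsub>M\<^esub> x = \<zero>\<^bsub>M\<^esub>"
      and y: "y \<in> carrier M" "\<And>v. var_power v n \<odot>\<^bsub>M\<^esub> y = \<zero>\<^bsub>M\<^esub>"
      using iff by blast
    have "var_power v (m + n) \<odot>\<^bsub>M\<^esub> (x \<oplus>\<^bsub>M\<^esub> y) = \<zero>\<^bsub>M\<^esub>" for v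
      using x y var_power_smult_mono[OF M x(1) x(2), of "m + n" v]
        var_power_smult_mono[OF M y(1) y(2), of "m + n" v]
      by (simp add: smult_r_distr)
    with x y show "x \<oplus>\<^bsub>M\<^esub> y \<in> \<Gamma>\<^sub>\<mm> M"
      unfolding iff by auto
  next
    fix r x assume "x \<in> \<Gamma>\<^sub>\<mm> M"
    then obtain n where x: "x \<in> carrier M" "\<And>v. var_power v n \<odot>\<^bsub>M\<^esub> x = \<zero>\<^bsub>M\<^esub>"
      using iff by blast
    have "var_power v n \<odot>\<^bsub>M\<^esub> (r \<odot>\<^bsub>M\<^esub> x) = \<zero>\<^bsub>M\<^esub>" for v
      using smult_assoc1[of "var_power v n" r x] smult_assoc1[of r "var_power v n" x] x
      by (simp add: mult.commute)
    with x show "r \<odot>\<^bsub>M\<^esub> x \<in> \<Gamma>\<^sub>\<mm> M"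
      unfolding iff by auto
  qed
qed

lemma torsion_hom:
  assumes "module_hom M N u" "x \<in> \<Gamma>\<^sub>\<mm> M"
  shows "u x \<in> \<Gamma>\<^sub>\<mm> N"
proof -
  interpret module_hom M N u by (rule assms)
  show ?thesis
    using assms(2) by (metis torsion_iff M.module_axioms N.module_axioms closed smult zero)
qed

lemma torsion_proj:
  assumes M: "graded_module M" and x: "x \<in> \<Gamma>\<^sub>\<mm> M"
  shows "proj M d x \<in> \<Gamma>\<^sub>\<mm> M"
proof -
  interpret graded_module M by (rule M)
  obtain n where n: "x \<in> carrier M" "\<And>v. var_power v n \<odot>\<^bsub>M\<^esub> x = \<zero>\<^bsub>M\<^esub>"
    using x torsion_iff[OF module_axioms] by blast
  have "var_power v n \<odot>\<^bsub>M\<^esub> proj M d x = \<zero>\<^bsub>M\<^esub>" for v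
    using proj_smult[OF M var_power_homogeneous n(1), of n d v] n(2) proj_component[OF component_zero]
    by simp
  then show ?thesis
    using n(1) by (auto simp: torsion_iff[OF module_axioms])
qed


section \<open>Gluing along the edges of a graph on four vertices\<close>

text \<open>The polynomials \<open>h v\<close> represent in \<open>R/I\<close> the products \<open>x\<^sub>v\<^sup>N e\<close> with an element \<open>e\<close> of some module
  containing \<open>R/I\<close>. The conclusion says that \<open>e\<close> can be taken to be \<open>(p, r)\<close> in \<open>R/K[T\<^sub>2] \<oplus> R/K[T\<^sub>3]\<close>:
  the ideals \<open>I\<close> and \<open>K[T\<^sub>3]\<close> agree after inverting \<open>x\<^sub>1\<close> or \<open>x\<^sub>2\<close>, and \<open>I\<close> and \<open>K[T\<^sub>2]\<close> after inverting \<open>x\<^sub>3\<close> or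
  \<open>x\<^sub>4\<close>.

  Fix an exponent \<open>\<alpha> \<in> \<nat>\<^sup>4\<close> and consider the graph on the four variables in which \<open>v\<close> is a vertex if
  \<open>\<alpha> + N e\<^sub>v\<close> is not an exponent of \<open>I\<close>, and \<open>{v, w}\<close> an edge if \<open>\<alpha> + N e\<^sub>v + N e\<^sub>w\<close> is not. As \<open>N\<close> is
  large, every vertex lies on an edge, and the edges are the complements of the pairs \<open>{i, j}\<close> for which
  \<open>\<alpha>\<^sub>i + \<alpha>\<^sub>j\<close> is smaller than the corresponding entry of \<open>a\<close>. The hypothesis on \<open>h\<close> says that the
  coefficient of \<open>h v\<close> at \<open>\<alpha> + N e\<^sub>v\<close> is constant along edges, hence is a single constant if the graph
  is connected. A graph without isolated vertices on at most four vertices is disconnected only if it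
  consists of two disjoint edges. The inequality on \<open>a\<close> rules out \<open>{13, 24}\<close> and \<open>{14, 23}\<close>: two
  failing conditions on complementary pairs give \<open>\<alpha>\<^sub>1 + \<dots> + \<alpha>\<^sub>4 < max(a\<^sub>2 + a\<^sub>5, a\<^sub>3 + a\<^sub>4)\<close>, while
  \<open>\<alpha>\<^sub>1 + \<alpha>\<^sub>2 \<ge> a\<^sub>1\<close> and \<open>\<alpha>\<^sub>3 + \<alpha>\<^sub>4 \<ge> a\<^sub>6\<close> give \<open>\<alpha>\<^sub>1 + \<dots> + \<alpha>\<^sub>4 \<ge> a\<^sub>1 + a\<^sub>6\<close>. There remains \<open>{12, 34}\<close>, the
  case \<open>\<alpha> \<in> S\<close>, in which \<open>r\<close> takes the value on \<open>12\<close> and \<open>p\<close> the value on \<open>34\<close>.\<close>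

lemma glue_along_edges:
  fixes h :: "var \<Rightarrow> 'k::field mpoly4"
  assumes a: "a1 + a6 \<ge> max (a2 + a5) (a3 + a4)"
    and N: "a1 + a2 + a3 + a4 + a5 + a6 \<le> N"
    and h: "\<And>v w. var_power w N * h v - var_power v N * h w \<in> monomial_span (T2 a1 a2 a3 a4 a5 \<inter> T3 a2 a3 a4 a5 a6)"
  obtains p r where "p - r \<in> monomial_span (T1 a2 a3 a4 a5)"
    "\<And>v. v \<in> {X1, X2} \<Longrightarrow> h v - var_power v N * r \<in> monomial_span (T2 a1 a2 a3 a4 a5 \<inter> T3 a2 a3 a4 a5 a6)"
    "\<And>v. v \<in> {X3, X4} \<Longrightarrow> h v - var_power v N * p \<in> monomial_span (T2 a1 a2 a3 a4 a5 \<inter> T3 a2 a3 a4 a5 a6)"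
proof -
  let ?T = "T2 a1 a2 a3 a4 a5 \<inter> T3 a2 a3 a4 a5 a6"
  let ?x = "\<lambda>v. Poly_Mapping.single v N :: expo"
  define c where "c v \<alpha> = coef (h v) (\<alpha> + ?x v)" for v \<alpha>
  define vertex where "vertex v \<alpha> \<longleftrightarrow> \<alpha> + ?x v \<notin> ?T" for v \<alpha>
  have edge: "c v \<alpha> = c w \<alpha>" if "\<alpha> + ?x v + ?x w \<notin> ?T" for v w \<alpha>
  proof -
    have "coef (var_power w N * h v) (\<alpha> + ?x v + ?x w) = coef (var_power v N * h w) (\<alpha> + ?x w + ?x v)"
      using h[of w v] that by (simp add: monomial_span_iff lookup_minus add.assoc add.commute[of "?x v"])
    then show ?thesis
      unfolding lookup_var_power_mult_add by (simp add: c_def)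
  qed
  \<comment> \<open>The coefficients of \<open>h v\<close> that do not correspond to any \<open>\<alpha> \<in> \<nat>\<^sup>4\<close>.\<close>
  have boundary: "coef (h v) y = 0" if y: "y \<notin> ?T" and v: "coord y v < N" for v y
  proof -
    \<comment> \<open>A pair on which \<open>y\<close> fails misses two variables, one of which differs from \<open>v\<close>.\<close>
    have "\<exists>w. w \<noteq> v \<and> y + ?x w \<notin> ?T"
    proof (rule ccontr)
      assume "\<not> ?thesis"
      then have "w \<noteq> v \<Longrightarrow> y + ?x w \<in> ?T" for w by blast
      from this[of X1] this[of X2] this[of X3] this[of X4] y show False
        by (cases v) (simp_all add: T1_def T2_def T3_def coord_single)
    qed
    then obtain w where w: "w \<noteq> v" "y + ?x w \<notin> ?T" by blast
    have "coef (var_power w N * h v) (y + ?x w) = coef (var_power v N * h w) (y + ?x w)"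
      using h[of w v] w by (simp add: monomial_span_iff lookup_minus)
    also have "\<dots> = 0"
      using v w by (simp add: lookup_var_power_mult coord_single)
    finally show ?thesis
      unfolding lookup_var_power_mult_add .
  qed
  \<comment> \<open>\<open>r\<close> prefers the values at the vertices \<open>1, 2\<close> and \<open>p\<close> those at \<open>3, 4\<close>; the other vertices serve as
    a fallback, so that \<open>p\<close> and \<open>r\<close> agree where the graph is connected.\<close>
  define first where "first vs \<alpha> = (case filter (\<lambda>v. vertex v \<alpha>) vs of [] \<Rightarrow> 0 | v # _ \<Rightarrow> c v \<alpha>)" for vs \<alpha>
  have fin: "finite {\<alpha>. first vs \<alpha> \<noteq> 0}" for vs
  proof (rule finite_subset)
    show "{\<alpha>. first vs \<alpha> \<noteq> 0} \<subseteq> (\<Union>v\<in>set vs. (\<lambda>y. y - ?x v) ` Poly_Mapping.keys (h v))"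
    proof
      fix \<alpha> assume "\<alpha> \<in> {\<alpha>. first vs \<alpha> \<noteq> 0}"
      then obtain v ws where v: "filter (\<lambda>v. vertex v \<alpha>) vs = v # ws" "c v \<alpha> \<noteq> 0"
        by (auto simp: first_def split: list.splits)
      then have "v \<in> set vs"
        by (metis filter_is_subset list.set_intros(1) subsetD)
      moreover have "\<alpha> = (\<alpha> + ?x v) - ?x v" "\<alpha> + ?x v \<in> Poly_Mapping.keys (h v)"
        using v by (simp_all add: c_def in_keys_iff)
      ultimately show "\<alpha> \<in> (\<Union>v\<in>set vs. (\<lambda>y. y - ?x v) ` Poly_Mapping.keys (h v))"
        by blast
    qed
  qed simp
  define r where "r = Abs_poly_mapping (first [X1, X2, X3, X4])"
  define p where "p = Abs_poly_mapping (first [X3, X4, X1, X2])"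
  have coef_r: "coef r \<alpha> = first [X1, X2, X3, X4] \<alpha>" and coef_p: "coef p \<alpha> = first [X3, X4, X1, X2] \<alpha>" for \<alpha>
    using fin by (simp_all add: r_def p_def)
  have coords: "\<alpha> + ?x v \<notin> ?T \<longleftrightarrow>
      (v \<notin> {X1, X2} \<and> coord \<alpha> X1 + coord \<alpha> X2 < a1) \<or> (v \<notin> {X1, X3} \<and> coord \<alpha> X1 + coord \<alpha> X3 < a2) \<or>
      (v \<notin> {X1, X4} \<and> coord \<alpha> X1 + coord \<alpha> X4 < a3) \<or> (v \<notin> {X2, X3} \<and> coord \<alpha> X2 + coord \<alpha> X3 < a4) \<or>
      (v \<notin> {X2, X4} \<and> coord \<alpha> X2 + coord \<alpha> X4 < a5) \<or> (v \<notin> {X3, X4} \<and> coord \<alpha> X3 + coord \<alpha> X4 < a6)" for \<alpha> v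
    using N by (cases v) (auto simp: T1_def T2_def T3_def coord_single)
  have agree: "(vertex X1 \<alpha> \<longrightarrow> coef r \<alpha> = c X1 \<alpha>) \<and> (vertex X2 \<alpha> \<longrightarrow> coef r \<alpha> = c X2 \<alpha>) \<and>
      (vertex X3 \<alpha> \<longrightarrow> coef p \<alpha> = c X3 \<alpha>) \<and> (vertex X4 \<alpha> \<longrightarrow> coef p \<alpha> = c X4 \<alpha>) \<and>
      (\<alpha> \<notin> T1 a2 a3 a4 a5 \<longrightarrow> coef p \<alpha> = coef r \<alpha>)" for \<alpha>
  proof -
    define f12 where "f12 \<longleftrightarrow> coord \<alpha> X1 + coord \<alpha> X2 < a1"
    define f13 where "f13 \<longleftrightarrow> coord \<alpha> X1 + coord \<alpha> X3 < a2"
    define f14 where "f14 \<longleftrightarrow> coord \<alpha> X1 + coord \<alpha> X4 < a3"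
    define f23 where "f23 \<longleftrightarrow> coord \<alpha> X2 + coord \<alpha> X3 < a4"
    define f24 where "f24 \<longleftrightarrow> coord \<alpha> X2 + coord \<alpha> X4 < a5"
    define f34 where "f34 \<longleftrightarrow> coord \<alpha> X3 + coord \<alpha> X4 < a6"
    note f = f12_def f13_def f14_def f23_def f24_def f34_def
    have v: "vertex X1 \<alpha> \<longleftrightarrow> f23 \<or> f24 \<or> f34" "vertex X2 \<alpha> \<longleftrightarrow> f13 \<or> f14 \<or> f34"
      "vertex X3 \<alpha> \<longleftrightarrow> f12 \<or> f14 \<or> f24" "vertex X4 \<alpha> \<longleftrightarrow> f12 \<or> f13 \<or> f23"
      unfolding vertex_def coords f by auto
    have e: "f12 \<Longrightarrow> c X4 \<alpha> = c X3 \<alpha>" "f13 \<Longrightarrow> c X4 \<alpha> = c X2 \<alpha>" "f14 \<Longrightarrow> c X3 \<alpha> = c X2 \<alpha>"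
      "f23 \<Longrightarrow> c X4 \<alpha> = c X1 \<alpha>" "f24 \<Longrightarrow> c X3 \<alpha> = c X1 \<alpha>" "f34 \<Longrightarrow> c X2 \<alpha> = c X1 \<alpha>"
      by (rule edge; simp add: T1_def T2_def T3_def f coord_single)+
    have disj: "f13 \<and> f24 \<Longrightarrow> f12 \<or> f34" "f14 \<and> f23 \<Longrightarrow> f12 \<or> f34"
      using a unfolding f by auto
    have T1: "\<alpha> \<notin> T1 a2 a3 a4 a5 \<longleftrightarrow> f13 \<or> f14 \<or> f23 \<or> f24"
      by (auto simp: T1_def f)
    have r: "coef r \<alpha> = (if vertex X1 \<alpha> then c X1 \<alpha> else if vertex X2 \<alpha> then c X2 \<alpha>
        else if vertex X3 \<alpha> then c X3 \<alpha> else if vertex X4 \<alpha> then c X4 \<alpha> else 0)"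
      and p: "coef p \<alpha> = (if vertex X3 \<alpha> then c X3 \<alpha> else if vertex X4 \<alpha> then c X4 \<alpha>
        else if vertex X1 \<alpha> then c X1 \<alpha> else if vertex X2 \<alpha> then c X2 \<alpha> else 0)"
      unfolding coef_r coef_p first_def by simp_all
    have "vertex X1 \<alpha> \<Longrightarrow> vertex X2 \<alpha> \<Longrightarrow> c X1 \<alpha> = c X2 \<alpha>"
      "vertex X3 \<alpha> \<Longrightarrow> vertex X4 \<alpha> \<Longrightarrow> c X3 \<alpha> = c X4 \<alpha>"
      unfolding v using e disj by metis+
    moreover have "vertex u \<alpha> \<Longrightarrow> vertex w \<alpha> \<Longrightarrow> c w \<alpha> = c u \<alpha>"
      if "\<alpha> \<notin> T1 a2 a3 a4 a5" "u \<in> {X1, X2}" "w \<in> {X3, X4}" for u w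
      using that e disj unfolding T1 by (elim insertE emptyE; simp only: v; metis)
    ultimately show ?thesis
      unfolding r p by auto
  qed
  have glue: "h v - var_power v N * q \<in> monomial_span ?T"
    if q: "\<And>\<alpha>. vertex v \<alpha> \<Longrightarrow> coef q \<alpha> = c v \<alpha>" for v q
    unfolding monomial_span_iff
  proof (intro allI impI)
    fix y assume y: "y \<notin> ?T"
    show "coef (h v - var_power v N * q) y = 0"
    proof (cases "N \<le> coord y v")
      case True
      then have "(y - ?x v) + ?x v = y"
        using add_diff_single[of N y v] by (simp add: add.commute)
      with q[of "y - ?x v"] y True show ?thesis
        by (simp add: lookup_minus lookup_var_power_mult vertex_def c_def)
    next
      case False
      with boundary[OF y] show ?thesis
        by (simp add: lookup_minus lookup_var_power_mult)
    qed
  qed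
  show thesis
  proof (rule that[of p r])
    show "p - r \<in> monomial_span (T1 a2 a3 a4 a5)"
      unfolding monomial_span_iff lookup_minus using agree by simp
  qed (use glue agree in auto)
qed


section \<open>The first local cohomology of a tetrahedral curve\<close>

text \<open>Here \<open>\<eta>\<close> is the composite \<open>R \<rightarrow> R/I \<rightarrow> E\<^sup>0\<close>. The map \<open>\<phi>\<close> extends to \<open>R\<close> the homomorphism
  \<open>K[T\<^sub>2] + K[T\<^sub>3] \<rightarrow> E\<^sup>0\<close> that is zero on \<open>K[T\<^sub>2]\<close> and \<open>\<eta>\<close> on \<open>K[T\<^sub>3]\<close>, which is well-defined because
  \<open>\<eta>\<close> vanishes on \<open>I = K[T\<^sub>2] \<inter> K[T\<^sub>3]\<close>. For \<open>f \<in> K[T\<^sub>1]\<close>, \<open>\<phi> f\<close> plays the role of the class \<open>(f, 0)\<close>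
  in \<open>R/K[T\<^sub>2] \<oplus> R/K[T\<^sub>3]\<close>, where \<open>R/I\<close> is embedded diagonally.\<close>

locale extended_augmentation =
  E0: graded_module E0 + E1: graded_module E1 +
  \<eta>: module_hom "regular_module :: ('k::field mpoly4, _) grmod" E0 \<eta> +
  \<phi>: module_hom "regular_module :: ('k::field mpoly4, _) grmod" E0 \<phi> +
  d0: module_hom E0 E1 d0 + d1: module_hom E1 E2 d1
  for E0 E1 E2 :: "('k::field mpoly4, 'e) grmod" and \<eta> \<phi> d0 d1 +
  fixes a1 a2 a3 a4 a5 a6 :: nat
  assumes a: "a1 + a6 \<ge> max (a2 + a5) (a3 + a4)"
    and \<eta>_zero_iff: "\<eta> f = \<zero>\<^bsub>E0\<^esub> \<longleftrightarrow> f \<in> monomial_span (T2 a1 a2 a3 a4 a5 \<inter> T3 a2 a3 a4 a5 a6)"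
    and \<eta>_range: "range \<eta> = a_kernel E0 E1 d0"
    and d0_range: "d0 ` carrier E0 = a_kernel E1 E2 d1"
    and d0_graded: "d0 \<in> graded_hom E0 E1"
    and \<phi>_T2: "f \<in> monomial_span (T2 a1 a2 a3 a4 a5) \<Longrightarrow> \<phi> f = \<zero>\<^bsub>E0\<^esub>"
    and \<phi>_T3: "f \<in> monomial_span (T3 a2 a3 a4 a5 a6) \<Longrightarrow> \<phi> f = \<eta> f"
    and \<phi>_component: "f \<in> homogeneous d \<Longrightarrow> \<phi> f \<in> component E0 d"
    and \<phi>_proj: "proj E0 d (\<phi> f) = \<phi> (homogeneous_part d f)"
begin

lemmas graded = E0.graded_module_axioms E1.graded_module_axioms

abbreviation "t1 \<equiv> T1 a2 a3 a4 a5"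
abbreviation "t2 \<equiv> T2 a1 a2 a3 a4 a5"
abbreviation "t3 \<equiv> T3 a2 a3 a4 a5 a6"

definition u :: "'k mpoly4 \<Rightarrow> 'e" where "u f = d0 (\<phi> f)"

abbreviation cocycles :: "'e set" where "cocycles \<equiv> \<Gamma>\<^sub>\<mm> E1 \<inter> a_kernel E1 E2 d1"
abbreviation coboundaries :: "'e set" where "coboundaries \<equiv> d0 ` \<Gamma>\<^sub>\<mm> E0"

lemma module_hom_u: "module_hom regular_module E1 u"
proof
  show "u x \<in> carrier E1" for x
    by (simp add: u_def)
  show "u (x \<oplus>\<^bsub>regular_module\<^esub> y) = u x \<oplus>\<^bsub>E1\<^esub> u y" for x y
    using \<phi>.add[of x y] by (simp add: u_def d0.add)
  show "u (r \<odot>\<^bsub>regular_module\<^esub> x) = r \<odot>\<^bsub>E1\<^esub> u x" for x r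
    using \<phi>.smult[of x r] by (simp add: u_def d0.smult)
qed

interpretation u: module_hom "regular_module :: ('k mpoly4, _) grmod" E1 u
  by (rule module_hom_u)

lemma d0_\<eta>: "d0 (\<eta> f) = \<zero>\<^bsub>E1\<^esub>"
  using \<eta>_range by (auto simp: a_kernel_iff)

lemma \<eta>_eq_iff: "\<eta> f = \<eta> g \<longleftrightarrow> f - g \<in> monomial_span (t2 \<inter> t3)"
  using \<eta>.diff[of f g] \<eta>_zero_iff[of "f - g"] E0.M.minus_eq_zero_iff[of "\<eta> f" "\<eta> g"] by simp

text \<open>A high power of \<open>x\<^sub>1\<close> or \<open>x\<^sub>2\<close> moves \<open>T\<^sub>1\<close> into \<open>T\<^sub>2\<close>, one of \<open>x\<^sub>3\<close> or \<open>x\<^sub>4\<close> moves it into \<open>T\<^sub>3\<close>.\<close>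

lemma \<phi>_var_power:
  assumes f: "f \<in> monomial_span t1" and N: "a1 + a6 \<le> N"
  shows "v \<in> {X1, X2} \<Longrightarrow> \<phi> (var_power v N * f) = \<zero>\<^bsub>E0\<^esub>"
    and "v \<in> {X3, X4} \<Longrightarrow> \<phi> (var_power v N * f) = \<eta> (var_power v N * f)"
proof -
  have t1: "y \<in> t1" if "coef (var_power v N * f) y \<noteq> 0" for y v
    using monomial_span_mult[OF upset_T(1) f, of "var_power v N"] that
    unfolding monomial_span_iff by blast
  have N_le: "N \<le> coord y v" if "coef (var_power v N * f) y \<noteq> 0" for y v
    using that by (simp add: lookup_var_power_mult split: if_splits)
  show "\<phi> (var_power v N * f) = \<zero>\<^bsub>E0\<^esub>" if "v \<in> {X1, X2}"
  proof (rule \<phi>_T2, unfold monomial_span_iff, intro allI impI, rule ccontr)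
    fix y assume y: "y \<notin> t2" "coef (var_power v N * f) y \<noteq> 0"
    show False
      using t1[OF y(2)] N_le[OF y(2)] y(1) N that by (auto simp: T2_def)
  qed
  show "\<phi> (var_power v N * f) = \<eta> (var_power v N * f)" if "v \<in> {X3, X4}"
  proof (rule \<phi>_T3, unfold monomial_span_iff, intro allI impI, rule ccontr)
    fix y assume y: "y \<notin> t3" "coef (var_power v N * f) y \<noteq> 0"
    show False
      using t1[OF y(2)] N_le[OF y(2)] y(1) N that by (auto simp: T3_def)
  qed
qed

lemma u_cocycle:
  assumes f: "f \<in> monomial_span t1"
  shows "u f \<in> cocycles"
proof -
  have "var_power v (a1 + a6) \<odot>\<^bsub>E1\<^esub> u f = \<zero>\<^bsub>E1\<^esub>" for v
  proof -
    have "var_power v (a1 + a6) \<odot>\<^bsub>E1\<^esub> u f = d0 (\<phi> (var_power v (a1 + a6) * f))"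
      using u.smult[of f "var_power v (a1 + a6)"] by (simp add: u_def)
    also have "\<dots> = \<zero>\<^bsub>E1\<^esub>"
      using \<phi>_var_power[OF f order.refl, of v] d0_\<eta> by (cases v) auto
    finally show ?thesis .
  qed
  then have "u f \<in> \<Gamma>\<^sub>\<mm> E1"
    unfolding torsion_iff[OF E1.module_axioms] using u.closed[of f] by auto
  moreover have "u f \<in> a_kernel E1 E2 d1"
    unfolding d0_range[symmetric] u_def by auto
  ultimately show ?thesis by blast
qed

text \<open>The kernel of \<open>u\<close> modulo coboundaries: if \<open>\<phi> f\<close> equals \<open>\<eta> r\<close> up to torsion, then \<open>r\<close> lies in
  \<open>K[T\<^sub>3]\<close> and \<open>f - r\<close> in \<open>K[T\<^sub>2]\<close>. Two variables suffice to detect this: each of the conditions that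
  define \<open>T\<^sub>3\<close> misses \<open>x\<^sub>1\<close> or \<open>x\<^sub>2\<close>, and each of those that define \<open>T\<^sub>2\<close> misses \<open>x\<^sub>3\<close> or \<open>x\<^sub>4\<close>.\<close>

lemma u_coboundary_iff:
  assumes f: "f \<in> monomial_span t1"
  shows "u f \<in> coboundaries \<longleftrightarrow> f \<in> monomial_span (t2 \<union> t3)"
proof
  assume "f \<in> monomial_span (t2 \<union> t3)"
  then have parts: "f - restrict_to t3 f \<in> monomial_span t2" "restrict_to t3 f \<in> monomial_span t3"
    by (rule restrict_to_complement, rule restrict_to_in_span)
  have "\<phi> f = \<phi> (f - restrict_to t3 f) \<oplus>\<^bsub>E0\<^esub> \<phi> (restrict_to t3 f)"
    using \<phi>.add[of "f - restrict_to t3 f" "restrict_to t3 f"] by simp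
  also have "\<dots> = \<eta> (restrict_to t3 f)"
    using \<phi>_T2[OF parts(1)] \<phi>_T3[OF parts(2)] \<eta>.closed[of "restrict_to t3 f"] by simp
  finally have "u f = d0 \<zero>\<^bsub>E0\<^esub>"
    by (simp add: u_def d0_\<eta>)
  moreover have "\<zero>\<^bsub>E0\<^esub> \<in> \<Gamma>\<^sub>\<mm> E0"
    by (simp add: torsion_iff[OF E0.module_axioms])
  ultimately show "u f \<in> coboundaries" by blast
next
  assume "u f \<in> coboundaries"
  then obtain t where t: "t \<in> \<Gamma>\<^sub>\<mm> E0" "u f = d0 t" by blast
  then obtain n where n: "t \<in> carrier E0" "\<And>v. var_power v n \<odot>\<^bsub>E0\<^esub> t = \<zero>\<^bsub>E0\<^esub>"
    using torsion_iff[OF E0.module_axioms] by blast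
  define N where "N = n + a1 + a6"
  have \<phi>f: "\<phi> f \<in> carrier E0"
    using \<phi>.closed[of f] by simp
  have "d0 (\<phi> f \<ominus>\<^bsub>E0\<^esub> t) = \<zero>\<^bsub>E1\<^esub>"
    using t \<phi>f n(1) d0.closed[OF n(1)] by (simp add: d0.diff u_def[symmetric] E1.M.minus_eq_zero_iff)
  then have "\<phi> f \<ominus>\<^bsub>E0\<^esub> t \<in> range \<eta>"
    using \<phi>f n(1) by (simp add: \<eta>_range a_kernel_iff)
  then obtain r where r: "\<phi> f \<ominus>\<^bsub>E0\<^esub> t = \<eta> r" by blast
  have \<phi>\<eta>: "\<phi> (var_power v N * f) = \<eta> (var_power v N * r)" for v
  proof -
    have "var_power v N \<odot>\<^bsub>E0\<^esub> t = \<zero>\<^bsub>E0\<^esub>"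
      by (rule var_power_smult_mono[OF E0.module_axioms n]) (simp add: N_def)
    moreover have "var_power v N \<odot>\<^bsub>E0\<^esub> (\<phi> f \<ominus>\<^bsub>E0\<^esub> t) = var_power v N \<odot>\<^bsub>E0\<^esub> \<phi> f \<ominus>\<^bsub>E0\<^esub> var_power v N \<odot>\<^bsub>E0\<^esub> t"
      using \<phi>f n(1) by (simp add: a_minus_def E0.smult_r_distr E0.smult_r_minus)
    ultimately have "\<eta> (var_power v N * r) = var_power v N \<odot>\<^bsub>E0\<^esub> \<phi> f \<ominus>\<^bsub>E0\<^esub> \<zero>\<^bsub>E0\<^esub>"
      using r \<eta>.smult[of r "var_power v N"] by simp
    also have "\<dots> = \<phi> (var_power v N * f)"
      using \<phi>.smult[of f "var_power v N"] \<phi>.closed[of "var_power v N * f"]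
        E0.M.minus_equality[of "\<zero>\<^bsub>E0\<^esub>" "\<zero>\<^bsub>E0\<^esub>"] by (simp add: a_minus_def)
    finally show ?thesis ..
  qed
  have N: "a1 + a6 \<le> N"
    by (simp add: N_def)
  have r12: "var_power v N * r \<in> monomial_span (t2 \<inter> t3)" if "v \<in> {X1, X2}" for v
    unfolding \<eta>_zero_iff[symmetric] \<phi>\<eta>[symmetric] by (rule \<phi>_var_power(1)[OF f N that])
  have r34: "var_power v N * (f - r) \<in> monomial_span (t2 \<inter> t3)" if "v \<in> {X3, X4}" for v
    unfolding right_diff_distrib \<eta>_eq_iff[symmetric] \<phi>\<eta>[symmetric]
    by (rule \<phi>_var_power(2)[OF f N that, symmetric])
  have shift: "y + Poly_Mapping.single v N \<in> t2 \<inter> t3"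
    if q: "var_power v N * q \<in> monomial_span (t2 \<inter> t3)" "coef q y \<noteq> 0" for q y v
  proof (rule ccontr)
    assume "y + Poly_Mapping.single v N \<notin> t2 \<inter> t3"
    with q(1) have "coef (var_power v N * q) (y + Poly_Mapping.single v N) = 0"
      unfolding monomial_span_iff by blast
    with q(2) show False
      by (simp add: lookup_var_power_mult_add)
  qed
  have "r \<in> monomial_span t3"
    unfolding monomial_span_iff
  proof (intro allI impI, rule ccontr)
    fix y assume y: "y \<notin> t3" "coef r y \<noteq> 0"
    with shift[OF r12[of X1] y(2)] shift[OF r12[of X2] y(2)] show False
      by (auto simp: T1_def T2_def T3_def coord_single)
  qed
  moreover have "f - r \<in> monomial_span t2"
    unfolding monomial_span_iff
  proof (intro allI impI, rule ccontr)
    fix y assume y: "y \<notin> t2" "coef (f - r) y \<noteq> 0"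
    with shift[OF r34[of X3] y(2)] shift[OF r34[of X4] y(2)] show False
      by (auto simp: T1_def T2_def T3_def coord_single)
  qed
  ultimately have "(f - r) + r \<in> monomial_span (t2 \<union> t3)"
    by (intro monomial_span_add) (auto simp: monomial_span_def)
  then show "f \<in> monomial_span (t2 \<union> t3)" by simp
qed

text \<open>Surjectivity: if \<open>d\<^sup>0 e\<close> is torsion, then all \<open>x\<^sub>v\<^sup>N e\<close> are in the image of \<open>\<eta>\<close>, and gluing their
  representatives shows that \<open>e\<close> agrees with \<open>\<phi> f + \<eta> r\<close> up to torsion.\<close>

lemma cocycle_decomposition:
  assumes z: "z \<in> cocycles"
  shows "\<exists>f\<in>monomial_span t1. \<exists>t\<in>\<Gamma>\<^sub>\<mm> E0. z = u f \<oplus>\<^bsub>E1\<^esub> d0 t"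
proof -
  obtain e where e: "e \<in> carrier E0" "z = d0 e"
    using z d0_range by blast
  obtain n where n: "z \<in> carrier E1" "\<And>v. var_power v n \<odot>\<^bsub>E1\<^esub> z = \<zero>\<^bsub>E1\<^esub>"
    using z torsion_iff[OF E1.module_axioms] by blast
  define N where "N = n + (a1 + a2 + a3 + a4 + a5 + a6)"
  have "var_power v N \<odot>\<^bsub>E0\<^esub> e \<in> range \<eta>" for v
  proof -
    have "d0 (var_power v N \<odot>\<^bsub>E0\<^esub> e) = \<zero>\<^bsub>E1\<^esub>"
      using var_power_smult_mono[OF E1.module_axioms n, of N v] e by (simp add: d0.smult N_def)
    then show ?thesis
      using e by (simp add: \<eta>_range a_kernel_iff)
  qed
  then have "\<forall>v. \<exists>p. var_power v N \<odot>\<^bsub>E0\<^esub> e = \<eta> p" by blast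
  then obtain h where h: "\<And>v. var_power v N \<odot>\<^bsub>E0\<^esub> e = \<eta> (h v)" by metis
  have compat: "var_power w N * h v - var_power v N * h w \<in> monomial_span (t2 \<inter> t3)" for v w
  proof -
    have swap: "\<eta> (var_power w N * h v) = (var_power w N * var_power v N) \<odot>\<^bsub>E0\<^esub> e" for v w
      using \<eta>.smult[of "h v" "var_power w N"] h[of v] E0.smult_assoc1[of "var_power w N" "var_power v N" e] e
      by simp
    show ?thesis
      unfolding \<eta>_eq_iff[symmetric] swap by (simp add: mult.commute)
  qed
  have "a1 + a2 + a3 + a4 + a5 + a6 \<le> N"
    by (simp add: N_def)
  from a this compat obtain p r where f: "p - r \<in> monomial_span t1"
    and r: "\<And>v. v \<in> {X1, X2} \<Longrightarrow> h v - var_power v N * r \<in> monomial_span (t2 \<inter> t3)"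
    and p: "\<And>v. v \<in> {X3, X4} \<Longrightarrow> h v - var_power v N * p \<in> monomial_span (t2 \<inter> t3)"
    by (rule glue_along_edges) blast
  define s where "s = \<phi> (p - r) \<oplus>\<^bsub>E0\<^esub> \<eta> r"
  have s: "s \<in> carrier E0"
    using \<phi>.closed[of "p - r"] \<eta>.closed[of r] by (simp add: s_def)
  have "var_power v N \<odot>\<^bsub>E0\<^esub> s = \<eta> (h v)" for v
  proof -
    have "var_power v N \<odot>\<^bsub>E0\<^esub> s = \<phi> (var_power v N * (p - r)) \<oplus>\<^bsub>E0\<^esub> \<eta> (var_power v N * r)"
      using \<phi>.closed[of "p - r"] \<eta>.closed[of r] \<phi>.smult[of "p - r" "var_power v N"] \<eta>.smult[of r "var_power v N"]
      by (simp add: s_def E0.smult_r_distr)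
    also have "\<dots> = \<eta> (h v)"
    proof (cases "v \<in> {X1, X2}")
      case True
      then have "\<phi> (var_power v N * (p - r)) = \<zero>\<^bsub>E0\<^esub>"
        by (intro \<phi>_var_power[OF f]) (auto simp: N_def)
      with r[OF True] show ?thesis
        using \<eta>.closed[of "var_power v N * r"] by (simp add: \<eta>_eq_iff[symmetric])
    next
      case False
      then have v: "v \<in> {X3, X4}" by (cases v) auto
      then have "\<phi> (var_power v N * (p - r)) = \<eta> (var_power v N * (p - r))"
        by (intro \<phi>_var_power[OF f]) (auto simp: N_def)
      also have "\<dots> \<oplus>\<^bsub>E0\<^esub> \<eta> (var_power v N * r) = \<eta> (var_power v N * p)"
        using \<eta>.add[of "var_power v N * (p - r)" "var_power v N * r"] by (simp add: algebra_simps)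
      finally show ?thesis
        using p[OF v] by (simp add: \<eta>_eq_iff[symmetric])
    qed
    finally show ?thesis .
  qed
  then have "var_power v N \<odot>\<^bsub>E0\<^esub> (e \<ominus>\<^bsub>E0\<^esub> s) = \<zero>\<^bsub>E0\<^esub>" for v
    using e s h[of v] \<eta>.closed[of "h v"]
    by (simp add: a_minus_def E0.smult_r_distr E0.smult_r_minus E0.M.r_neg)
  then have t: "e \<ominus>\<^bsub>E0\<^esub> s \<in> \<Gamma>\<^sub>\<mm> E0"
    using e s by (auto simp: torsion_iff[OF E0.module_axioms])
  have ds: "d0 s = u (p - r)"
    using \<phi>.closed[of "p - r"] \<eta>.closed[of r] u.closed[of "p - r"]
    by (simp add: s_def d0.add d0_\<eta> u_def[symmetric])
  have "s \<oplus>\<^bsub>E0\<^esub> (e \<ominus>\<^bsub>E0\<^esub> s) = e"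
    using e s by (simp add: a_minus_def E0.M.a_ac E0.M.r_neg)
  then have "z = u (p - r) \<oplus>\<^bsub>E1\<^esub> d0 (e \<ominus>\<^bsub>E0\<^esub> s)"
    using d0.add[of s "e \<ominus>\<^bsub>E0\<^esub> s"] e s ds by simp
  with f t show ?thesis by blast
qed

lemma graded_isomorphic_u:
  "graded_isomorphic (quotient_grmod (sub_grmod E1 cocycles) coboundaries)
     (quotient_grmod (sub_grmod regular_module (monomial_span t1)) (monomial_span (t2 \<union> t3)))"
proof -
  have cocyc: "submodule cocycles polyring E1"
    by (intro submodule_Int submodule_torsion d1.submodule_kernel E1.module_axioms)
  have cobound: "submodule coboundaries polyring E1"
    by (intro d0.submodule_image submodule_torsion E0.module_axioms)
  have sub: "coboundaries \<subseteq> cocycles"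
    using torsion_hom[OF d0.module_hom_axioms] d0_range torsion_iff[OF E0.module_axioms] by blast
  have span1: "submodule (monomial_span t1 :: 'k mpoly4 set) polyring regular_module"
    by (rule submodule_monomial_span[OF upset_T(1)])
  have cancel: "z \<ominus>\<^bsub>sub_grmod E1 cocycles\<^esub> u f \<in> coboundaries"
    if "z = u f \<oplus>\<^bsub>E1\<^esub> d0 t" "f \<in> monomial_span t1" "t \<in> \<Gamma>\<^sub>\<mm> E0" for z f t
  proof -
    have "t \<in> carrier E0"
      using that(3) torsion_iff[OF E0.module_axioms] by blast
    then have "z \<ominus>\<^bsub>E1\<^esub> u f = d0 t"
      using that(1) u.closed[of f] d0.closed[of t] by (simp add: a_minus_def E1.M.a_ac E1.M.r_neg2 E1.M.r_neg)
    with that(3) show ?thesis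
      using minus_sub_grmod[OF E1.module_axioms cocyc u_cocycle[OF that(2)], of z] by simp
  qed
  show ?thesis
  proof (rule quotient_graded_isomorphic[where u = u])
    show "module_hom (sub_grmod regular_module (monomial_span t1)) (sub_grmod E1 cocycles) u"
    proof (intro module_hom.intro module_hom_axioms.intro)
      show "module polyring (sub_grmod regular_module (monomial_span t1 :: 'k mpoly4 set))"
        by (rule module_sub_grmod[OF module_regular_module span1])
      show "module polyring (sub_grmod E1 cocycles)"
        by (rule module_sub_grmod[OF E1.module_axioms cocyc])
    qed (use u_cocycle u.add u.smult in \<open>auto simp: sub_grmod_def\<close>)
    show "submodule (monomial_span (t2 \<union> t3)) polyring (sub_grmod regular_module (monomial_span t1 :: 'k mpoly4 set))"
      by (intro submodule_sub_grmod module_regular_module submodule_monomial_span upset_Un upset_T monomial_span_mono)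
         (auto simp: T2_def T3_def)
    show "submodule coboundaries polyring (sub_grmod E1 cocycles)"
      by (rule submodule_sub_grmod[OF E1.module_axioms cobound cocyc sub])
    show "u x \<in> component (sub_grmod E1 cocycles) d"
      if "x \<in> component (sub_grmod regular_module (monomial_span t1)) d" for x d
      using that u_cocycle[of x] \<phi>_component[of x d] d0_graded
      by (auto simp: sub_grmod_def u_def graded_hom_def image_subset_iff)
    show "u x \<in> coboundaries \<longleftrightarrow> x \<in> monomial_span (t2 \<union> t3)"
      if "x \<in> carrier (sub_grmod regular_module (monomial_span t1))" for x
      using that u_coboundary_iff[of x] by (simp add: sub_grmod_def)
    show "\<exists>x\<in>carrier (sub_grmod regular_module (monomial_span t1)). z \<ominus>\<^bsub>sub_grmod E1 cocycles\<^esub> u x \<in> coboundaries"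
      if "z \<in> carrier (sub_grmod E1 cocycles)" for z
      using that cocycle_decomposition[of z] cancel by (fastforce simp: sub_grmod_def)
    show "\<exists>x\<in>component (sub_grmod regular_module (monomial_span t1)) d. z \<ominus>\<^bsub>sub_grmod E1 cocycles\<^esub> u x \<in> coboundaries"
      if z: "z \<in> component (sub_grmod E1 cocycles) d" for z d
    proof -
      have zc: "z \<in> cocycles" "z \<in> component E1 d"
        using z by (auto simp: sub_grmod_def)
      obtain f t where ft: "f \<in> monomial_span t1" "t \<in> \<Gamma>\<^sub>\<mm> E0" "z = u f \<oplus>\<^bsub>E1\<^esub> d0 t"
        using cocycle_decomposition[OF zc(1)] by blast
      have t: "t \<in> carrier E0"
        using ft(2) torsion_iff[OF E0.module_axioms] by blast
      have "z = proj E1 d (u f) \<oplus>\<^bsub>E1\<^esub> proj E1 d (d0 t)"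
        using E1.proj_component[OF zc(2)] E1.proj_add[of "u f" "d0 t" d] u.closed[of f] t ft(3) by simp
      also have "proj E1 d (u f) = u (homogeneous_part d f)"
        using proj_graded_hom[OF graded d0_graded, of "\<phi> f" d] \<phi>.closed[of f] \<phi>_proj by (simp add: u_def)
      also have "proj E1 d (d0 t) = d0 (proj E0 d t)"
        by (rule proj_graded_hom[OF graded d0_graded t])
      finally have "z \<ominus>\<^bsub>sub_grmod E1 cocycles\<^esub> u (homogeneous_part d f) \<in> coboundaries"
        by (rule cancel[OF _ homogeneous_part_span[OF ft(1)] torsion_proj[OF graded(1) ft(2)]])
      then show ?thesis
        using homogeneous_part_span[OF ft(1), of d] homogeneous_part_homogeneous[of d f]
        by (auto simp: sub_grmod_def)
    qed
  qed (auto simp: sub_grmod_def)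
qed

end

theorem proposition3p3:
  fixes a1 a2 a3 a4 a5 a6 :: nat
    and E :: "nat \<Rightarrow> ('k::field mpoly4, 'e) grmod"
    and \<epsilon> :: "'k mpoly4 set \<Rightarrow> 'e"
    and \<delta> :: "nat \<Rightarrow> 'e \<Rightarrow> 'e"
  assumes "\<not> (a1 = 0 \<and> a2 = 0 \<and> a3 = 0 \<and> a4 = 0 \<and> a5 = 0 \<and> a6 = 0)"
    and "a1 + a6 \<ge> max (a2 + a5) (a3 + a4)"
    and "graded_injective_resolution
           (quotient_grmod regular_module (tetrahedral_ideal a1 a2 a3 a4 a5 a6)) \<epsilon> E \<delta>"
  shows "graded_isomorphic (local_cohomology E \<delta> 1) (KS_module a1 a2 a3 a4 a5 a6)"
proof -
  let ?t1 = "T1 a2 a3 a4 a5" and ?t2 = "T2 a1 a2 a3 a4 a5" and ?t3 = "T3 a2 a3 a4 a5 a6"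
  define I where "I = (monomial_span (?t2 \<inter> ?t3) :: 'k mpoly4 set)"
  let ?Q = "quotient_grmod regular_module I :: ('k mpoly4, 'k mpoly4 set) grmod"
  have res: "graded_injective_resolution ?Q \<epsilon> E \<delta>"
    using assms(3) by (simp add: I_def tetrahedral_ideal_eq)
  have Q: "graded_module ?Q" and inj: "\<And>i. graded_injective (E i)"
    and \<epsilon>: "\<epsilon> \<in> graded_hom ?Q (E 0)" "inj_on \<epsilon> (carrier ?Q)"
      "\<epsilon> ` carrier ?Q = a_kernel (E 0) (E 1) (\<delta> 0)"
    and \<delta>: "\<And>i. \<delta> i \<in> graded_hom (E i) (E (Suc i))"
      "\<And>i. \<delta> i ` carrier (E i) = a_kernel (E (Suc i)) (E (Suc (Suc i))) (\<delta> (Suc i))"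
    using res unfolding graded_injective_resolution_def by blast+
  have E: "graded_module (E i)" for i
    using inj by (simp add: graded_injective_def)
  then have Em: "module polyring (E i)" for i
    by (rule graded_module.axioms)
  have Qm: "module polyring ?Q"
    by (rule graded_module.axioms[OF Q])
  have I: "submodule I polyring regular_module"
    unfolding I_def by (intro submodule_monomial_span upset_Int upset_T)
  interpret I: module_quotient "regular_module :: ('k mpoly4, _) grmod" I
    by (intro module_quotient.intro module_quotient_axioms.intro I module_regular_module)
  interpret \<epsilon>: module_hom ?Q "E 0" \<epsilon>
    by (rule graded_hom_module_hom[OF \<epsilon>(1) Qm Em])
  define \<eta> where "\<eta> f = \<epsilon> (I +>\<^bsub>regular_module\<^esub> f)" for f
  have cosets: "I +>\<^bsub>regular_module\<^esub> f \<in> carrier ?Q" for f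
    by (simp add: I.quotient_simps)
  interpret \<eta>: module_hom "regular_module :: ('k mpoly4, _) grmod" "E 0" \<eta>
  proof (intro module_hom.intro module_hom_axioms.intro module_regular_module Em)
    show "\<eta> x \<in> carrier (E 0)" for x
      using cosets by (simp add: \<eta>_def)
    show "\<eta> (x \<oplus>\<^bsub>regular_module\<^esub> y) = \<eta> x \<oplus>\<^bsub>E 0\<^esub> \<eta> y" for x y
      using \<epsilon>.add[OF cosets cosets, of x y] by (simp add: \<eta>_def I.quotient_simps)
    show "\<eta> (r \<odot>\<^bsub>regular_module\<^esub> x) = r \<odot>\<^bsub>E 0\<^esub> \<eta> x" for r x
      using \<epsilon>.smult[OF cosets, of r x] by (simp add: \<eta>_def I.quotient_simps)
  qed
  have \<eta>_zero: "\<eta> f = \<zero>\<^bsub>E 0\<^esub> \<longleftrightarrow> f \<in> I" for f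
  proof -
    have "\<eta> f = \<zero>\<^bsub>E 0\<^esub> \<longleftrightarrow> \<epsilon> (I +>\<^bsub>regular_module\<^esub> f) = \<epsilon> \<zero>\<^bsub>?Q\<^esub>"
      by (simp add: \<eta>_def)
    also have "\<dots> \<longleftrightarrow> I +>\<^bsub>regular_module\<^esub> f = \<zero>\<^bsub>?Q\<^esub>"
      by (intro inj_on_eq_iff[OF \<epsilon>(2)] cosets \<epsilon>.M.M.zero_closed)
    also have "\<dots> \<longleftrightarrow> f \<in> I"
      using I.coset_eq_A_iff[of f] by (simp add: I.quotient_simps)
    finally show ?thesis .
  qed
  have \<eta>_range: "range \<eta> = a_kernel (E 0) (E 1) (\<delta> 0)"
    unfolding \<epsilon>(3)[symmetric] I.quotient_simps by (simp add: \<eta>_def image_image)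
  have \<eta>_deg: "\<eta> f \<in> component (E 0) d" if "f \<in> homogeneous d" for f d
    using \<epsilon>(1) that by (simp add: graded_hom_def \<eta>_def I.quotient_simps image_subset_iff)
  have up: "upset (?t2 \<union> ?t3)"
    by (intro upset_Un upset_T)
  have \<eta>_add: "\<eta> (p + q) = \<eta> p \<oplus>\<^bsub>E 0\<^esub> \<eta> q" for p q
    using \<eta>.add[of p q] by simp
  define f where "f p = \<eta> (restrict_to ?t3 p)" for p
  have f_smult: "f (r * p) = r \<odot>\<^bsub>E 0\<^esub> f p" if p: "p \<in> monomial_span (?t2 \<union> ?t3)" for r p
  proof -
    \<comment> \<open>Restriction to \<open>T\<^sub>3\<close> is not \<open>R\<close>-linear, but the error is the part in \<open>T\<^sub>3\<close> of an element of \<open>K[T\<^sub>2]\<close>,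
      hence in \<open>I\<close>.\<close>
    let ?q = "restrict_to ?t3 p"
    have "restrict_to ?t3 (r * (p - ?q)) \<in> I"
      unfolding I_def
      by (rule restrict_to_span_Int[OF monomial_span_mult[OF upset_T(2) restrict_to_complement[OF p]]])
    moreover have "restrict_to ?t3 (r * ?q) = r * ?q"
      by (rule restrict_to_span_eq[OF monomial_span_mult[OF upset_T(3) restrict_to_in_span[OF p]]])
    moreover have "restrict_to ?t3 (r * p) = restrict_to ?t3 (r * (p - ?q)) + restrict_to ?t3 (r * ?q)"
      unfolding restrict_to_add[symmetric] by (simp flip: distrib_left)
    ultimately have "f (r * p) = \<eta> (r * ?q)"
      using \<eta>_zero \<eta>.closed[of "r * ?q"] by (simp add: f_def \<eta>_add)
    then show ?thesis
      using \<eta>.smult[of ?q r] by (simp add: f_def)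
  qed
  obtain g where g: "g \<in> graded_hom (ideal_copy UNIV) (E 0)"
    "\<And>p. p \<in> monomial_span (?t2 \<union> ?t3) \<Longrightarrow> g (encode p) = f p"
  proof (rule graded_injective_extend[OF inj up, of f 0])
    show "f p \<in> carrier (E 0)" for p
      using \<eta>.closed by (simp add: f_def)
    show "f (p + q) = f p \<oplus>\<^bsub>E 0\<^esub> f q" for p q
      by (simp add: f_def restrict_to_add \<eta>_add)
    show "f p \<in> component (E 0) d" if "p \<in> homogeneous d" for p d
      unfolding f_def using that
      by (intro \<eta>_deg) (auto simp: homogeneous_iff lookup_restrict_to when_def)
  qed (use f_smult in auto)
  interpret g: module_hom "ideal_copy UNIV :: ('k mpoly4, _) grmod" "E 0" g
    by (rule graded_hom_module_hom[OF g(1) module_ideal_copy[OF upset_UNIV] Em])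
  interpret extended_augmentation "E 0" "E 1" "E 2" \<eta> "g \<circ> encode" "\<delta> 0" "\<delta> 1" a1 a2 a3 a4 a5 a6
  proof (intro extended_augmentation.intro extended_augmentation_axioms.intro \<eta>.module_hom_axioms assms(2) E \<eta>_range)
    show "module_hom regular_module (E 0) (g \<circ> encode)"
    proof (intro module_hom.intro module_hom_axioms.intro module_regular_module Em)
      show "(g \<circ> encode) x \<in> carrier (E 0)" for x
        using g.closed[of "encode x"] by simp
      show "(g \<circ> encode) (x \<oplus>\<^bsub>regular_module\<^esub> y) = (g \<circ> encode) x \<oplus>\<^bsub>E 0\<^esub> (g \<circ> encode) y" for x y
        using g.add[of "encode x" "encode y"] by simp
      show "(g \<circ> encode) (r \<odot>\<^bsub>regular_module\<^esub> x) = r \<odot>\<^bsub>E 0\<^esub> (g \<circ> encode) x" for r x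
        using g.smult[of "encode x" r] by simp
    qed
    show "module_hom (E 0) (E 1) (\<delta> 0)" "module_hom (E 1) (E 2) (\<delta> 1)"
      using graded_hom_module_hom[OF \<delta>(1) Em Em, of 0] graded_hom_module_hom[OF \<delta>(1) Em Em, of 1]
      by (simp_all add: numeral_2_eq_2)
    show "\<eta> f = \<zero>\<^bsub>E 0\<^esub> \<longleftrightarrow> f \<in> monomial_span (?t2 \<inter> ?t3)" for f
      using \<eta>_zero by (simp add: I_def)
    show "\<delta> 0 ` carrier (E 0) = a_kernel (E 1) (E 2) (\<delta> 1)" "\<delta> 0 \<in> graded_hom (E 0) (E 1)"
      using \<delta>(1)[of 0] \<delta>(2)[of 0] by (simp_all add: numeral_2_eq_2)
    show "(g \<circ> encode) p = \<zero>\<^bsub>E 0\<^esub>" if p: "p \<in> monomial_span ?t2" for p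
    proof -
      have "p \<in> monomial_span (?t2 \<union> ?t3)"
        using p monomial_span_mono[of ?t2 "?t2 \<union> ?t3"] by blast
      then show ?thesis
        using g(2)[of p] restrict_to_span_Int[OF p, of ?t3] \<eta>_zero by (simp add: f_def I_def)
    qed
    show "(g \<circ> encode) p = \<eta> p" if p: "p \<in> monomial_span ?t3" for p
    proof -
      have "p \<in> monomial_span (?t2 \<union> ?t3)"
        using p monomial_span_mono[of ?t3 "?t2 \<union> ?t3"] by blast
      then show ?thesis
        using g(2)[of p] restrict_to_span_eq[OF p] by (simp add: f_def)
    qed
    show "(g \<circ> encode) p \<in> component (E 0) d" if "p \<in> homogeneous d" for p d
      using g(1) that by (simp add: graded_hom_def image_subset_iff)
    show "proj (E 0) d ((g \<circ> encode) p) = (g \<circ> encode) (homogeneous_part d p)" for d p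
      using proj_graded_hom[OF graded_module_ideal_copy[OF upset_UNIV] E g(1), of "encode p" d]
        proj_ideal_copy[OF upset_UNIV, of p d] by simp
  qed
  show ?thesis
    using graded_isomorphic_u
    by (simp add: local_cohomology_def KS_module_def set_add_monomial_span numeral_2_eq_2)
qed

end
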